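(* Let $\mathcal{A}=\bigoplus_{k=1}^N \mathcal{M}_{d_k}$ and let $\mathcal{B}\subseteq\mathcal{A}$ be a standard unital C*-subalgebra with standard basis $\beta_{\mathcal{B}}$. For each $B\in\beta_{\mathcal{B}}$ and $k\in[N]$, let $\Psi_B^{(k)}=\{(i,j)\in[d_k]\times[d_k] : B^{(k)}_{i,j}=1\}$ and let $|\Psi_B^{(k)}|$ denote its cardinality. Let $\mathbf{v}=(v_1,\ldots,v_N)\in(0,1)^N$ satisfy $\sum_{k=1}^N v_k=1$ (with $\mathbf{v}=(1)$ when $N=1$). If $A\in\mathcal{A}$, then \[ P^{\mathbf{v}}_{\mathcal{B}}(A)=\sum_{B\in\beta_{\mathcal{B}}}\frac{\sum_{k=1}^N\frac{v_k}{d_k}\sum_{(i,j)\in\Psi_B^{(k)}}A^{(k)}_{i,j}}{\sum_{k=1}^N\frac{|\Psi_B^{(k)}|\,v_k}{d_k}}\,B . \]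
   Context: Notation: $[N]=\{1,\ldots,N\}$; $\mathcal{M}_n$ is the C*-algebra of complex $n\times n$ matrices with the operator norm. For $N,d_1,\ldots,d_N\in\{1,2,\ldots\}$, $\bigoplus_{k=1}^N\mathcal{M}_{d_k}$ is a unital C*-algebra with coordinatewise operations and the maximum of the operator norms of the coordinates; its elements are written $A=(A^{(1)},\ldots,A^{(N)})$, and $A^{(k)}_{i,j}$ is the $(i,j)$-entry of $A^{(k)}$. A unital C*-subalgebra contains the unit of the ambient algebra. Refined partitions: a refined partition of $n$ is a formal expression $\lambda=(n_1^{m_1},\ldots,n_L^{m_L})$ with $n_i,m_i\in\{1,2,\ldots\}$ and $n=\sum_{i=1}^L m_in_i$ (the $n_i$ need not be distinct). Put $\mathcal{B}^n_\lambda=\bigoplus_{i=1}^L(I_{m_i}\otimes\mathcal{M}_{n_i})\subseteq\mathcal{M}_n$, i.e. the block-diagonal matrices $\mathrm{diag}(A_1,\ldots,A_1,A_2,\ldots,A_2,\ldots,A_L,\ldots,A_L)$ with $A_i\in\mathcal{M}_{n_i}$ repeated $m_i$ times. Standard subalgebras: a unital C*-subalgebra $\mathcal{B}\subseteq\bigoplus_{k=1}^N\mathcal{M}_{d_k}$ is standard if for each $k\in[N]$ its image under the projection $p_k$ onto the $k$th summand is $p_k(\mathcal{B})=\mathcal{B}^{d_k}_{\lambda_k}$ for some refined partition $\lambda_k$ of $d_k$. Let $E^{(k)}_{i,j}$ be the element with $1$ in the $(i,j)$-entry of the $k$th summand and zeros elsewhere (a matrix unit). A standard subalgebra is understood to have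 a standard basis $\beta_{\mathcal{B}}$: a linear basis of $\mathcal{B}$ each of whose elements is a matrix unit or a sum of distinct matrix units, such that the sets $\{(k;i,j):B^{(k)}_{i,j}=1\}$, $B\in\beta_{\mathcal{B}}$, are pairwise disjoint. Conditional expectation: for $\mathbf{v}$ as in the claim, $\tau_{\mathbf{v}}(A)=\sum_{k=1}^N\frac{v_k}{d_k}\mathrm{Tr}(A^{(k)})$ is a faithful tracial state. $P^{\mathbf{v}}_{\mathcal{B}}:\mathcal{A}\to\mathcal{B}$ is the unique $\tau_{\mathbf{v}}$-preserving conditional expectation onto $\mathcal{B}$; a conditional expectation onto $\mathcal B$ is a linear map $P:\mathcal A\to\mathcal B$ with $P(B)=B$ for $B\in\mathcal{B}$ and $\|P(A)\|\le\|A\|$ for $A\in\mathcal A$, and $\tau_{\mathbf v}$-preserving means $\tau_{\mathbf{v}}\circ P=\tau_{\mathbf{v}}$. Equivalently, it is the orthogonal projection of $\mathcal{A}$ onto $\mathcal{B}$ for the inner product $\langle A,B\rangle=\tau_{\mathbf{v}}(B^*A)$: for any basis $\beta$ of $\mathcal{B}$ orthogonal for this inner product, $P^{\mathbf{v}}_{\mathcal{B}}(A)=\sum_{B\in\beta}\frac{\langle A,B\rangle}{\langle B,B\rangle}B$. *)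

theory Defs
  imports
    "HOL-Analysis.L2_Norm"
    "Jordan_Normal_Form.VS_Connect"
    "Jordan_Normal_Form.Schur_Decomposition"
begin

text \<open>
  An element of the direct sum of the matrix algebras of sizes \<open>d 1, \<dots>, d N\<close> is an extensional
  family \<open>A\<close> with \<open>A k\<close> a \<open>d k \<times> d k\<close> matrix for \<open>k \<in> {1..N}\<close>. Summands are counted from 1, matrix
  rows and columns from 0 as in the matrix library, so the index set \<open>[n]\<close> of matrix entries
  is \<open>{..<n}\<close>.
\<close>

definition matrix_sum :: "nat \<Rightarrow> (nat \<Rightarrow> nat) \<Rightarrow> (complex, nat \<Rightarrow> complex mat) module" where
  "matrix_sum N d = \<lparr>
    carrier = (\<Pi>\<^sub>E k\<in>{1..N}. carrier_mat (d k) (d k)),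
    monoid.mult = (\<lambda>A B. \<lambda>k\<in>{1..N}. A k * B k),
    one = (\<lambda>k\<in>{1..N}. 1\<^sub>m (d k)),
    zero = (\<lambda>k\<in>{1..N}. 0\<^sub>m (d k) (d k)),
    add = (\<lambda>A B. \<lambda>k\<in>{1..N}. A k + B k),
    module.smult = (\<lambda>c A. \<lambda>k\<in>{1..N}. c \<cdot>\<^sub>m A k)\<rparr>"

definition ds_adjoint :: "nat \<Rightarrow> (nat \<Rightarrow> complex mat) \<Rightarrow> nat \<Rightarrow> complex mat" where
  "ds_adjoint N A = (\<lambda>k\<in>{1..N}. mat_adjoint (A k))"

definition vec_l2norm :: "complex vec \<Rightarrow> real" where
  "vec_l2norm x = L2_set (\<lambda>i. cmod (x $ i)) {..<dim_vec x}"

definition op_norm :: "complex mat \<Rightarrow> real" where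
  "op_norm M = Sup {vec_l2norm (M *\<^sub>v x) | x. x \<in> carrier_vec (dim_col M) \<and> vec_l2norm x \<le> 1}"

definition ds_norm :: "nat \<Rightarrow> (nat \<Rightarrow> complex mat) \<Rightarrow> real" where
  "ds_norm N A = Max ((\<lambda>k. op_norm (A k)) ` {1..N})"

definition unital_cstar_subalgebra ::
    "nat \<Rightarrow> (nat \<Rightarrow> nat) \<Rightarrow> (nat \<Rightarrow> complex mat) set \<Rightarrow> bool" where
  "unital_cstar_subalgebra N d \<B> \<longleftrightarrow>
    submodule class_ring \<B> (matrix_sum N d) \<and>
    \<one>\<^bsub>matrix_sum N d\<^esub> \<in> \<B> \<and>
    (\<forall>X\<in>\<B>. \<forall>Y\<in>\<B>. X \<otimes>\<^bsub>matrix_sum N d\<^esub> Y \<in> \<B>) \<and>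
    (\<forall>X\<in>\<B>. ds_adjoint N X \<in> \<B>) \<and>
    (\<forall>X. \<forall>A\<in>carrier (matrix_sum N d).
      (\<forall>m::nat. X m \<in> \<B>) \<and> (\<lambda>m. ds_norm N (X m \<ominus>\<^bsub>matrix_sum N d\<^esub> A)) \<longlonglongrightarrow> 0 \<longrightarrow> A \<in> \<B>)"

text \<open>The refined partition \<open>(n\<^sub>1^{m\<^sub>1}, \<dots>, n\<^sub>L^{m\<^sub>L})\<close> is the list of the pairs \<open>(n\<^sub>i, m\<^sub>i)\<close>.\<close>

definition refined_partition :: "nat \<Rightarrow> (nat \<times> nat) list \<Rightarrow> bool" where
  "refined_partition n lam \<longleftrightarrow>
    (\<forall>(ni, mi)\<in>set lam. 1 \<le> ni \<and> 1 \<le> mi) \<and> n = (\<Sum>(ni, mi)\<leftarrow>lam. mi * ni)"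

definition block_algebra :: "(nat \<times> nat) list \<Rightarrow> complex mat set" where
  "block_algebra lam =
    {diag_block_mat (concat (map2 (\<lambda>(ni, mi) M. replicate mi M) lam Ms)) | Ms.
      list_all2 (\<lambda>(ni, mi) M. M \<in> carrier_mat ni ni) lam Ms}"

definition standard_subalgebra ::
    "nat \<Rightarrow> (nat \<Rightarrow> nat) \<Rightarrow> (nat \<Rightarrow> complex mat) set \<Rightarrow> bool" where
  "standard_subalgebra N d \<B> \<longleftrightarrow>
    unital_cstar_subalgebra N d \<B> \<and>
    (\<forall>k\<in>{1..N}. \<exists>lam. refined_partition (d k) lam \<and> (\<lambda>X. X k) ` \<B> = block_algebra lam)"

definition positions :: "nat \<Rightarrow> (nat \<Rightarrow> nat) \<Rightarrow> (nat \<times> nat \<times> nat) set" where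
  "positions N d = (SIGMA k:{1..N}. {..<d k} \<times> {..<d k})"

definition matrix_unit ::
    "nat \<Rightarrow> (nat \<Rightarrow> nat) \<Rightarrow> nat \<Rightarrow> nat \<Rightarrow> nat \<Rightarrow> nat \<Rightarrow> complex mat" where
  "matrix_unit N d k i j =
    (\<lambda>l\<in>{1..N}. mat (d l) (d l) (\<lambda>(p, q). if l = k \<and> p = i \<and> q = j then 1 else 0))"

definition Psi :: "(nat \<Rightarrow> nat) \<Rightarrow> (nat \<Rightarrow> complex mat) \<Rightarrow> nat \<Rightarrow> (nat \<times> nat) set" where
  "Psi d X k = {(i, j). i < d k \<and> j < d k \<and> X k $$ (i, j) = 1}"

text \<open>
  A singleton \<open>S\<close> yields a matrix unit. The linear basis is that of the vector space \<open>\<B>\<close>,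
  which is the direct sum with its carrier replaced.
\<close>

definition standard_basis ::
    "nat \<Rightarrow> (nat \<Rightarrow> nat) \<Rightarrow> (nat \<Rightarrow> complex mat) set \<Rightarrow> (nat \<Rightarrow> complex mat) set \<Rightarrow> bool" where
  "standard_basis N d \<B> \<beta> \<longleftrightarrow>
    vectorspace.basis class_ring (matrix_sum N d\<lparr>carrier := \<B>\<rparr>) \<beta> \<and>
    (\<forall>X\<in>\<beta>. \<exists>S. S \<subseteq> positions N d \<and> S \<noteq> {} \<and>
      X = (\<Oplus>\<^bsub>matrix_sum N d\<^esub> s\<in>S. case s of (k, i, j) \<Rightarrow> matrix_unit N d k i j)) \<and>
    disjoint_family_on (\<lambda>X. SIGMA k:{1..N}. Psi d X k) \<beta>"

definition weight_vector :: "nat \<Rightarrow> (nat \<Rightarrow> real) \<Rightarrow> bool" where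
  "weight_vector N v \<longleftrightarrow>
    (if N = 1 then v 1 = 1 else (\<forall>k\<in>{1..N}. 0 < v k \<and> v k < 1) \<and> (\<Sum>k=1..N. v k) = 1)"

definition mat_tr :: "complex mat \<Rightarrow> complex" where
  "mat_tr M = (\<Sum>i<dim_row M. M $$ (i, i))"

definition tau :: "nat \<Rightarrow> (nat \<Rightarrow> nat) \<Rightarrow> (nat \<Rightarrow> real) \<Rightarrow> (nat \<Rightarrow> complex mat) \<Rightarrow> complex" where
  "tau N d v A = (\<Sum>k=1..N. complex_of_real (v k / real (d k)) * mat_tr (A k))"

definition conditional_expectation ::
    "nat \<Rightarrow> (nat \<Rightarrow> nat) \<Rightarrow> (nat \<Rightarrow> complex mat) set \<Rightarrow>
      ((nat \<Rightarrow> complex mat) \<Rightarrow> (nat \<Rightarrow> complex mat)) \<Rightarrow> bool" where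
  "conditional_expectation N d \<B> P \<longleftrightarrow>
    linear_map class_ring (matrix_sum N d) (matrix_sum N d\<lparr>carrier := \<B>\<rparr>) P \<and>
    (\<forall>X\<in>\<B>. P X = X) \<and>
    (\<forall>A\<in>carrier (matrix_sum N d). ds_norm N (P A) \<le> ds_norm N A)"

text \<open>
  The map is a function on the carrier of the direct sum only; extensionality fixes its values
  outside, which is needed for uniqueness.
\<close>

definition cond_exp ::
    "nat \<Rightarrow> (nat \<Rightarrow> nat) \<Rightarrow> (nat \<Rightarrow> real) \<Rightarrow> (nat \<Rightarrow> complex mat) set \<Rightarrow>
      (nat \<Rightarrow> complex mat) \<Rightarrow> (nat \<Rightarrow> complex mat)" where
  "cond_exp N d v \<B> = (THE P.
    P \<in> extensional (carrier (matrix_sum N d)) \<and>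
    conditional_expectation N d \<B> P \<and>
    (\<forall>A\<in>carrier (matrix_sum N d). tau N d v (P A) = tau N d v A))"

end

theory Submission
  imports Defs
begin

text \<open>
  The direct sum is a tracial star algebra whose norm is the norm of left multiplication for the
  2-norm \<open>norm2 x = tr (x\<^sup>* x)\<^sup>1\<^sup>/\<^sup>2\<close>; this is all that is used about the operator norm.

  The orthogonal projection \<open>E\<close> onto \<open>\<B>\<close> is a right \<open>\<B>\<close>-module map, so left multiplication by
  \<open>c = E a\<close> on \<open>\<B>\<close> has norm at most \<open>K = \<parallel>a\<parallel>\<close>. Hence the iterated squares \<open>D\<close> of \<open>c\<^sup>* c\<close> grow at
  most like powers of \<open>K\<close>, and repeated use of the Cauchy-Schwarz inequality turns this into
  \<open>\<parallel>c x\<parallel> \<le> K \<parallel>x\<parallel>\<close> for every \<open>x\<close>, that is, \<open>\<parallel>E a\<parallel> \<le> \<parallel>a\<parallel>\<close>.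

  Conversely let \<open>P\<close> be a trace-preserving contraction onto \<open>\<B>\<close> and \<open>x\<close> self-adjoint. Applying \<open>P\<close> to
  \<open>1 + i t x\<close> shows that \<open>P x\<close> has a real numerical range. Applying it to \<open>1 + i t x - t\<^sup>2 x\<^sup>2 / 2\<close>,
  which is unitary up to order \<open>t\<^sup>4\<close>, and comparing the coefficients of \<open>t\<^sup>2\<close> in the 2-norms
  gives that \<open>P\<close> does not increase the 2-norm of \<open>x\<close>; therefore \<open>P\<close> is the orthogonal projection.
\<close>

subsection \<open>Tracial star algebras\<close>

text \<open>The axioms make \<open>tr (adj y \<otimes> x)\<close> an inner product in which
  multiplication by \<open>a\<close>, on either side, has multiplication by \<open>adj a\<close> on
  the same side as its adjoint.\<close>

locale tracial_star_algebra = module class_ring M + ring M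
  for M :: "(complex, 'a, 'm) module_scheme" (structure) +
  fixes adj :: "'a \<Rightarrow> 'a" and tr :: "'a \<Rightarrow> complex"
  assumes smult_mult_left: "x \<in> carrier M \<Longrightarrow> y \<in> carrier M \<Longrightarrow> (c \<odot> x) \<otimes> y = c \<odot> (x \<otimes> y)"
    and smult_mult_right: "x \<in> carrier M \<Longrightarrow> y \<in> carrier M \<Longrightarrow> x \<otimes> (c \<odot> y) = c \<odot> (x \<otimes> y)"
    and adj_closed [simp]: "x \<in> carrier M \<Longrightarrow> adj x \<in> carrier M"
    and adj_adj [simp]: "x \<in> carrier M \<Longrightarrow> adj (adj x) = x"
    and adj_add: "x \<in> carrier M \<Longrightarrow> y \<in> carrier M \<Longrightarrow> adj (x \<oplus> y) = adj x \<oplus> adj y"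
    and adj_smult: "x \<in> carrier M \<Longrightarrow> adj (c \<odot> x) = cnj c \<odot> adj x"
    and adj_mult: "x \<in> carrier M \<Longrightarrow> y \<in> carrier M \<Longrightarrow> adj (x \<otimes> y) = adj y \<otimes> adj x"
    and tr_add: "x \<in> carrier M \<Longrightarrow> y \<in> carrier M \<Longrightarrow> tr (x \<oplus> y) = tr x + tr y"
    and tr_smult: "x \<in> carrier M \<Longrightarrow> tr (c \<odot> x) = c * tr x"
    and tr_mult_commute: "x \<in> carrier M \<Longrightarrow> y \<in> carrier M \<Longrightarrow> tr (x \<otimes> y) = tr (y \<otimes> x)"
    and tr_adj: "x \<in> carrier M \<Longrightarrow> tr (adj x) = cnj (tr x)"
    and tr_pos: "x \<in> carrier M \<Longrightarrow> 0 \<le> Re (tr (adj x \<otimes> x))"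
    and tr_faithful: "x \<in> carrier M \<Longrightarrow> tr (adj x \<otimes> x) = 0 \<Longrightarrow> x = \<zero>"
begin

lemma smult_carrier [simp]: "x \<in> carrier M \<Longrightarrow> c \<odot> x \<in> carrier M"
  by (rule smult_closed) simp_all

lemma adj_one [simp]: "adj \<one> = \<one>"
proof -
  have "\<one> = adj (adj \<one> \<otimes> \<one>)" by simp
  also have "\<dots> = adj \<one> \<otimes> adj (adj \<one>)" by (simp only: adj_mult adj_closed one_closed)
  finally show ?thesis by simp
qed

definition ip :: "'a \<Rightarrow> 'a \<Rightarrow> complex" where
  "ip x y = tr (adj y \<otimes> x)"

lemma ip_add_left [simp]:
  "\<lbrakk>x \<in> carrier M; y \<in> carrier M; z \<in> carrier M\<rbrakk> \<Longrightarrow> ip (x \<oplus> y) z = ip x z + ip y z"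
  by (simp add: ip_def r_distr tr_add)

lemma ip_add_right [simp]:
  "\<lbrakk>x \<in> carrier M; y \<in> carrier M; z \<in> carrier M\<rbrakk> \<Longrightarrow> ip x (y \<oplus> z) = ip x y + ip x z"
  by (simp add: ip_def l_distr tr_add adj_add)

lemma ip_smult_left [simp]:
  "\<lbrakk>x \<in> carrier M; y \<in> carrier M\<rbrakk> \<Longrightarrow> ip (c \<odot> x) y = c * ip x y"
  by (simp add: ip_def smult_mult_right tr_smult)

lemma ip_smult_right [simp]:
  "\<lbrakk>x \<in> carrier M; y \<in> carrier M\<rbrakk> \<Longrightarrow> ip x (c \<odot> y) = cnj c * ip x y"
  by (simp add: ip_def smult_mult_left tr_smult adj_smult)

lemma cnj_ip: "\<lbrakk>x \<in> carrier M; y \<in> carrier M\<rbrakk> \<Longrightarrow> cnj (ip x y) = ip y x"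
  by (simp add: ip_def adj_mult flip: tr_adj)

lemma ip_mult_left:
  "\<lbrakk>a \<in> carrier M; x \<in> carrier M; y \<in> carrier M\<rbrakk> \<Longrightarrow> ip (a \<otimes> x) y = ip x (adj a \<otimes> y)"
  by (simp add: ip_def adj_mult m_assoc)

text \<open>Traciality enters here: \<open>a\<close> is moved cyclically to the other end. The right
  module property of the projection rests on this.\<close>

lemma ip_mult_right:
  assumes "a \<in> carrier M" "x \<in> carrier M" "y \<in> carrier M"
  shows "ip (x \<otimes> a) y = ip x (y \<otimes> adj a)"
  using assms tr_mult_commute[of "adj y \<otimes> x" a] by (simp add: ip_def adj_mult m_assoc)

lemma ip_zero [simp]: "y \<in> carrier M \<Longrightarrow> ip \<zero> y = 0"
  using ip_add_left[of \<zero> \<zero> y] by simp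

lemma tr_eq_ip: "x \<in> carrier M \<Longrightarrow> tr x = ip x \<one>"
  by (simp add: ip_def)

lemma Im_ip_self_adjoint:
  assumes "x \<in> carrier M" "adj x = x" "y \<in> carrier M"
  shows "Im (ip y (x \<otimes> y)) = 0"
proof -
  have "cnj (ip y (x \<otimes> y)) = ip y (x \<otimes> y)"
    using assms by (simp add: cnj_ip ip_mult_left)
  then show ?thesis by (metis cnj.simps(2) equal_neg_zero)
qed

section \<open>The 2-norm of the trace form\<close>

definition norm2 :: "'a \<Rightarrow> real" where
  "norm2 x = sqrt (Re (ip x x))"

lemma norm2_nonneg [simp]: "0 \<le> norm2 x" if "x \<in> carrier M"
  using that tr_pos[of x] by (simp add: norm2_def ip_def)

lemma norm2_sq: "x \<in> carrier M \<Longrightarrow> (norm2 x)\<^sup>2 = Re (ip x x)"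
  using tr_pos[of x] by (simp add: norm2_def ip_def)

lemma ip_self: "x \<in> carrier M \<Longrightarrow> ip x x = complex_of_real ((norm2 x)\<^sup>2)"
  using cnj_ip[of x x] by (simp add: norm2_sq complex_eq_iff)

lemma norm2_eq_0: "x \<in> carrier M \<Longrightarrow> norm2 x = 0 \<Longrightarrow> x = \<zero>"
  using ip_self[of x] tr_faithful[of x] by (simp add: ip_def)

lemma norm2_zero [simp]: "norm2 \<zero> = 0"
  by (simp add: norm2_def)

lemma norm2_adj: "x \<in> carrier M \<Longrightarrow> norm2 (adj x) = norm2 x"
  by (simp add: norm2_def ip_def tr_mult_commute[of x])

lemma norm2_sq_add:
  assumes "x \<in> carrier M" "y \<in> carrier M"
  shows "(norm2 (x \<oplus> y))\<^sup>2 = (norm2 x)\<^sup>2 + (norm2 y)\<^sup>2 + 2 * Re (ip x y)"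
proof -
  have "Re (ip y x) = Re (ip x y)" using cnj_ip[of x y] assms by (metis complex_cnj(1) complex_surj complex.sel(1))
  then show ?thesis using assms by (simp add: norm2_sq)
qed

lemma norm2_sq_smult:
  assumes "x \<in> carrier M"
  shows "(norm2 (c \<odot> x))\<^sup>2 = (cmod c)\<^sup>2 * (norm2 x)\<^sup>2"
proof -
  have "ip (c \<odot> x) (c \<odot> x) = (c * cnj c) * ip x x" using assms by simp
  also have "\<dots> = complex_of_real ((cmod c)\<^sup>2 * (norm2 x)\<^sup>2)"
    by (simp add: ip_self assms flip: complex_norm_square)
  finally show ?thesis by (simp add: norm2_sq assms)
qed

lemma Cauchy_Schwarz:
  assumes "x \<in> carrier M" "y \<in> carrier M"
  shows "cmod (ip x y) \<le> norm2 x * norm2 y"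
proof (cases "norm2 y = 0")
  case True
  then have "y = \<zero>" using assms norm2_eq_0 by blast
  then have "ip x y = 0" using assms cnj_ip[of y x] by simp
  then show ?thesis using assms by simp
next
  case False
  define s where "s = norm2 y"
  have s: "s > 0" using False norm2_nonneg[of y, OF assms(2)] by (simp add: s_def)
  \<comment> \<open>This \<open>c\<close> minimises \<open>norm2 (x \<oplus> c \<odot> y)\<close>;
    at the minimum, nonnegativity of the square is the desired inequality.\<close>
  define c where "c = - ip x y / complex_of_real (s\<^sup>2)"
  have "cnj c * ip x y = - complex_of_real ((cmod (ip x y))\<^sup>2 / s\<^sup>2)"
    using s complex_norm_square[of "ip x y"] by (simp add: c_def field_simps)
  then have "Re (cnj c * ip x y) = - (cmod (ip x y))\<^sup>2 / s\<^sup>2" by (metis Re_complex_of_real uminus_complex.simps(1) minus_divide_left)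
  moreover have "(cmod c)\<^sup>2 * s\<^sup>2 = (cmod (ip x y))\<^sup>2 / s\<^sup>2"
    using s by (simp add: c_def norm_divide power_divide norm_power) (simp add: power2_eq_square power4_eq_xxxx field_simps)
  moreover have "(norm2 (x \<oplus> c \<odot> y))\<^sup>2 = (norm2 x)\<^sup>2 + (cmod c)\<^sup>2 * s\<^sup>2 + 2 * Re (cnj c * ip x y)"
    using assms by (simp add: norm2_sq_add norm2_sq_smult s_def)
  ultimately have "0 \<le> (norm2 x)\<^sup>2 - (cmod (ip x y))\<^sup>2 / s\<^sup>2"
    by (smt (verit) zero_le_power2 minus_divide_left)
  then have "(cmod (ip x y))\<^sup>2 \<le> (norm2 x * s)\<^sup>2"
    using s by (simp add: field_simps)
  then show ?thesis using assms by (simp add: s_def abs_le_square_iff[symmetric])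
qed

lemma smult_add_same:
  "x \<in> carrier M \<Longrightarrow> a \<odot> x \<oplus> b \<odot> x = (a + b) \<odot> x"
  using smult_l_distr[of a b x] by simp

lemma smult_smult: "x \<in> carrier M \<Longrightarrow> a \<odot> (b \<odot> x) = (a * b) \<odot> x"
  using smult_assoc1[of a b x] by simp

lemma smult_one' [simp]: "x \<in> carrier M \<Longrightarrow> 1 \<odot> x = x"
  using smult_one[of x] by simp

text \<open>Cartesian decomposition: the term after the outer \<open>\<i>\<close> is the imaginary
  part (x - adj x) / (2 i), written with scalars instead of subtraction.\<close>

lemma self_adjoint_decomposition:
  assumes "x \<in> carrier M"
  shows "x = ((1/2) \<odot> (x \<oplus> adj x)) \<oplus> \<i> \<odot> ((\<i>/2) \<odot> (adj x \<oplus> (-1) \<odot> x))"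
proof -
  have "((1/2) \<odot> (x \<oplus> adj x)) \<oplus> \<i> \<odot> ((\<i>/2) \<odot> (adj x \<oplus> (-1) \<odot> x))
    = ((1/2) \<odot> x \<oplus> (1/2) \<odot> adj x) \<oplus> ((-1/2) \<odot> adj x \<oplus> (1/2) \<odot> x)"
    using assms smult_r_distr[of "1/2" x "adj x"] smult_r_distr[of "-1/2" "adj x" "(-1) \<odot> x"] by (simp add: smult_smult)
  also have "\<dots> = ((1/2) \<odot> x \<oplus> (1/2) \<odot> x) \<oplus> ((1/2) \<odot> adj x \<oplus> (-1/2) \<odot> adj x)"
    using assms by (simp add: a_ac)
  also have "\<dots> = x"
  proof -
    have "0 \<odot> adj x = \<zero>" using lmult_0[of "adj x"] assms by simp
    then show ?thesis using assms by (simp add: smult_add_same)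
  qed
  finally show ?thesis by simp
qed

lemma ip_finsum:
  assumes "f \<in> S \<rightarrow> carrier M" "y \<in> carrier M"
  shows "ip (finsum M f S) y = (\<Sum>s\<in>S. ip (f s) y)"
  using assms by (induction S rule: infinite_finite_induct) (auto simp: Pi_iff)

end

subsection \<open>Trace-preserving expectations\<close>

lemma le_of_power_le_mult:
  fixes r q s c :: real
  assumes "0 \<le> q" "0 < s" and le: "\<And>p. r ^ 2 ^ p * s \<le> q ^ 2 ^ p * c"
  shows "r \<le> q"
proof (rule ccontr)
  assume "\<not> r \<le> q"
  then have rq: "q < r" by simp
  show False
  proof (cases "q = 0")
    case True
    then show False using le[of 0] rq assms by (simp add: mult_le_0_iff)
  next
    case False
    with assms have q: "0 < q" by simp
    \<comment> \<open>Since \<open>r / q\<close> exceeds 1, its powers outgrow the fixed ratio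
      \<open>c / s\<close>. The exponents \<open>2 ^ p\<close> come from iterated squaring;
      \<open>p = n\<close> already suffices.\<close>
    then obtain n where n: "c / s < (r / q) ^ n"
      using rq real_arch_pow[of "r / q" "c / s"] by auto
    have "(r / q) ^ n \<le> (r / q) ^ 2 ^ n"
      using q rq by (intro power_increasing) (auto simp: less_imp_le)
    moreover have "(r / q) ^ 2 ^ n \<le> c / s"
      using le[of n] q \<open>0 < s\<close> by (simp add: power_divide field_simps)
    ultimately show False using n by simp
  qed
qed

text \<open>Near 0 the linear term dominates, and both signs of \<open>t\<close> are allowed. The
  single value \<open>t = a / e\<close> with \<open>e > c\<close> takes the place of a
  limit.\<close>

lemma zero_of_mult_le_square:
  fixes a c :: real
  assumes "\<And>t. t * a \<le> t\<^sup>2 * c"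
  shows "a = 0"
proof -
  define e where "e = \<bar>c\<bar> + 1"
  have e: "e > 0" "c \<le> e - 1" by (auto simp: e_def)
  have "a / e * a \<le> (a / e)\<^sup>2 * c" by (rule assms)
  then have "a\<^sup>2 * e \<le> a\<^sup>2 * c" using e by (simp add: field_simps power2_eq_square)
  also have "\<dots> \<le> a\<^sup>2 * (e - 1)" using e by (intro mult_left_mono) auto
  also have "\<dots> = a\<^sup>2 * e - a\<^sup>2" by (simp add: algebra_simps)
  finally show "a = 0" by simp
qed

text \<open>After division by \<open>t\<^sup>2\<close> the right-hand side tends to 0 with
  \<open>t\<close>; the \<open>t\<close> chosen in the proof makes it at most
  \<open>a / 2\<close>.\<close>

lemma nonpos_of_square_mult_le:
  fixes a c c' :: real
  assumes "\<And>t. 0 < t \<Longrightarrow> t\<^sup>2 * a \<le> t ^ 4 * c + t ^ 3 * c'"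
  shows "a \<le> 0"
proof (rule ccontr)
  assume "\<not> a \<le> 0"
  then have a: "0 < a" by simp
  define e where "e = \<bar>c\<bar> + \<bar>c'\<bar> + 1"
  define t where "t = min 1 (a / (2 * e))"
  have e: "0 < e" by (simp add: e_def)
  have t: "0 < t" "t \<le> 1" "t * e \<le> a / 2"
    using a e by (auto simp: t_def min_def field_simps)
  have "t\<^sup>2 * a \<le> t\<^sup>2 * (t * (t * c + c'))"
    using assms[OF t(1)] by (simp add: power2_eq_square power3_eq_cube power4_eq_xxxx algebra_simps)
  then have "a \<le> t * (t * c + c')" using t by simp
  also have "t * (t * c + c') \<le> t * (\<bar>c\<bar> + \<bar>c'\<bar>)"
  proof (intro mult_left_mono)
    have "t * c \<le> t * \<bar>c\<bar>" "t * \<bar>c\<bar> \<le> \<bar>c\<bar>"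
      using t by (auto intro: mult_left_mono mult_left_le_one_le)
    then show "t * c + c' \<le> \<bar>c\<bar> + \<bar>c'\<bar>" by simp
  qed (use t in simp)
  also have "\<dots> \<le> a / 2" using t by (simp add: e_def algebra_simps)
  finally show False using a by simp
qed

text \<open>An affine function bounded above on the whole line is constant.\<close>

lemma slope_zero_of_bounded:
  fixes p c :: real
  assumes "\<And>s. s * p \<le> c"
  shows "p = 0"
proof (rule ccontr)
  assume "p \<noteq> 0"
  then show False using assms[of "(c + 1) / p"] by simp
qed

text \<open>Together \<open>norm2_mult_le\<close> and \<open>nrm_le\<close> say that
  \<open>nrm x\<close> is the least bound of left multiplication by \<open>x\<close>, so every
  estimate of \<open>nrm\<close> becomes one of \<open>norm2\<close>.\<close>

locale tracial_cstar_algebra = tracial_star_algebra M adj tr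
  for M :: "(complex, 'a, 'm) module_scheme" (structure) and adj tr +
  fixes nrm :: "'a \<Rightarrow> real"
  assumes nrm_nonneg: "x \<in> carrier M \<Longrightarrow> 0 \<le> nrm x"
    and norm2_mult_le: "x \<in> carrier M \<Longrightarrow> y \<in> carrier M \<Longrightarrow> norm2 (x \<otimes> y) \<le> nrm x * norm2 y"
    and nrm_le: "x \<in> carrier M \<Longrightarrow> 0 \<le> K \<Longrightarrow>
      (\<And>y. y \<in> carrier M \<Longrightarrow> norm2 (x \<otimes> y) \<le> K * norm2 y) \<Longrightarrow> nrm x \<le> K"

locale unital_star_subalgebra = tracial_cstar_algebra M adj tr nrm
  for M :: "(complex, 'a, 'm) module_scheme" (structure) and adj tr nrm +
  fixes B :: "'a set"
  assumes sub_carrier: "B \<subseteq> carrier M"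
    and sub_one [simp]: "\<one> \<in> B"
    and sub_add [simp]: "x \<in> B \<Longrightarrow> y \<in> B \<Longrightarrow> x \<oplus> y \<in> B"
    and sub_smult [simp]: "x \<in> B \<Longrightarrow> c \<odot> x \<in> B"
    and sub_mult [simp]: "x \<in> B \<Longrightarrow> y \<in> B \<Longrightarrow> x \<otimes> y \<in> B"
    and sub_adj [simp]: "x \<in> B \<Longrightarrow> adj x \<in> B"
begin

lemma sub_closed [simp]: "x \<in> B \<Longrightarrow> x \<in> carrier M"
  using sub_carrier by blast

text \<open>The difference lies in \<open>B\<close>, so it may be tested against itself.\<close>

lemma sub_eqI:
  assumes x: "x \<in> B" and y: "y \<in> B" and eq: "\<And>b. b \<in> B \<Longrightarrow> ip x b = ip y b"
  shows "x = y"
proof -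
  define d where "d = x \<oplus> (- 1) \<odot> y"
  have d: "d \<in> B" using x y by (simp add: d_def)
  have "ip d d = ip x d - ip y d"
    using x y d by (subst (1) d_def) simp
  also have "\<dots> = 0" using eq[OF d] by simp
  finally have "d = \<zero>" using tr_faithful[of d] d by (simp add: ip_def)
  moreover have "d = x \<ominus> y"
    using y smult_minus_1[of y] by (simp add: d_def a_minus_def class_ring_simps)
  ultimately show ?thesis using x y by simp
qed

text \<open>A bound known only on vectors of \<open>B\<close> is extended to all of
  \<open>M\<close>. For a general vector, high powers of \<open>adj c \<otimes> c\<close> obey the
  bound up to a factor depending on the vector, and extracting roots of order \<open>2 ^ p\<close>
  removes this factor.\<close>

lemma nrm_le_on_sub:
  assumes c: "c \<in> B" and K: "0 \<le> K"
    and le: "\<And>x. x \<in> B \<Longrightarrow> norm2 (c \<otimes> x) \<le> K * norm2 x"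
  shows "nrm c \<le> K"
proof (rule nrm_le)
  \<comment> \<open>The usual argument that an adjoint has the same bound; it stays inside
    \<open>B\<close> because \<open>adj c \<otimes> x\<close> is again in \<open>B\<close>.\<close>
  have le_adj: "norm2 (adj c \<otimes> x) \<le> K * norm2 x" if x: "x \<in> B" for x
  proof (cases "norm2 (adj c \<otimes> x) = 0")
    case True
    then show ?thesis using K x by simp
  next
    case False
    define u where "u = norm2 (adj c \<otimes> x)"
    have u: "0 < u" using False x c by (simp add: u_def less_le)
    have "u\<^sup>2 = Re (ip x (c \<otimes> (adj c \<otimes> x)))"
      using x c by (simp add: u_def norm2_sq ip_mult_left)
    also have "\<dots> \<le> norm2 x * norm2 (c \<otimes> (adj c \<otimes> x))"
      using Cauchy_Schwarz[of x "c \<otimes> (adj c \<otimes> x)"] complex_Re_le_cmod x c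
      by (meson order_trans sub_closed sub_mult sub_adj)
    also have "\<dots> \<le> norm2 x * (K * u)"
      using x c le[of "adj c \<otimes> x"] unfolding u_def by (intro mult_left_mono) auto
    finally have "u * u \<le> (K * norm2 x) * u" by (simp add: power2_eq_square algebra_simps)
    then show ?thesis using u by (simp add: u_def)
  qed
  \<comment> \<open>\<open>Q p\<close> is the power of \<open>adj c \<otimes> c\<close> with
    exponent \<open>2 ^ p\<close>, built by squaring so that one use of Cauchy-Schwarz leads from
    \<open>p\<close> to \<open>Suc p\<close>.\<close>
  define Q where "Q p = ((\<lambda>y. y \<otimes> y) ^^ p) (adj c \<otimes> c)" for p
  have Q_Suc: "Q (Suc p) = Q p \<otimes> Q p" for p by (simp add: Q_def)
  have Q_sub [simp]: "Q p \<in> B" for p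
    by (induction p) (use c in \<open>simp_all add: Q_def\<close>)
  have Q_adj [simp]: "adj (Q p) = Q p" for p
  proof (induction p)
    case 0
    then show ?case using c by (simp add: Q_def adj_mult)
  next
    case (Suc p)
    then show ?case by (simp add: Q_Suc adj_mult)
  qed
  have Q_le: "norm2 (Q p \<otimes> x) \<le> (K\<^sup>2) ^ 2 ^ p * norm2 x" if "x \<in> B" for p x
    using that
  proof (induction p arbitrary: x)
    case 0
    have "norm2 (adj c \<otimes> (c \<otimes> x)) \<le> K * norm2 (c \<otimes> x)" using 0 c by (simp add: le_adj)
    also have "\<dots> \<le> K * (K * norm2 x)" using 0 K le by (intro mult_left_mono) auto
    finally show ?case using 0 c by (simp add: Q_def m_assoc power2_eq_square mult.assoc)
  next
    case (Suc p)
    have "norm2 (Q p \<otimes> (Q p \<otimes> x)) \<le> (K\<^sup>2) ^ 2 ^ p * norm2 (Q p \<otimes> x)"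
      using Suc.prems by (intro Suc.IH) simp
    also have "\<dots> \<le> (K\<^sup>2) ^ 2 ^ p * ((K\<^sup>2) ^ 2 ^ p * norm2 x)"
      using Suc.IH[OF Suc.prems] K by (intro mult_left_mono) auto
    also have "\<dots> = (K\<^sup>2) ^ 2 ^ Suc p * norm2 x" by (simp add: mult_2 power_add)
    finally show ?case using Suc.prems by (simp add: Q_Suc m_assoc)
  qed
  fix x assume x: "x \<in> carrier M"
  show "norm2 (c \<otimes> x) \<le> K * norm2 x"
  proof (cases "norm2 x = 0")
    case True
    then show ?thesis using norm2_eq_0[OF x] c by simp
  next
    case False
    define s where "s = norm2 x"
    define r where "r = (norm2 (c \<otimes> x))\<^sup>2"
    define g where "g p = norm2 (Q p \<otimes> x)" for p
    define C where "C = nrm (adj x) * norm2 \<one>"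
    have s: "0 < s" using False norm2_nonneg[OF x] by (simp add: s_def)
    have g_nonneg: "0 \<le> g p" for p using x by (simp add: g_def)
    have CS: "Re (ip x y) \<le> s * norm2 y" if "y \<in> carrier M" for y
      using Cauchy_Schwarz[OF x that] complex_Re_le_cmod[of "ip x y"] by (simp add: s_def)
    have r_le: "r \<le> s * g 0"
      using CS[of "adj c \<otimes> (c \<otimes> x)"] x c
      by (simp add: r_def g_def Q_def norm2_sq ip_mult_left m_assoc)
    have g_sq: "(g p)\<^sup>2 \<le> s * g (Suc p)" for p
      using CS[of "Q p \<otimes> (Q p \<otimes> x)"] x
      by (simp add: g_def Q_Suc norm2_sq ip_mult_left m_assoc)
    \<comment> \<open>Free of denominators, this says that \<open>r / s\<^sup>2\<close> to the power
      \<open>2 ^ p\<close> is at most \<open>g p / s\<close>.\<close>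
    have r_pow: "r ^ 2 ^ p * s \<le> g p * (s\<^sup>2) ^ 2 ^ p" for p
    proof (induction p)
      case 0
      show ?case using r_le s by (simp add: power2_eq_square mult.commute)
    next
      case (Suc p)
      define R where "R = r ^ 2 ^ p"
      define S where "S = (s\<^sup>2) ^ 2 ^ p"
      have "0 \<le> R * s" using s by (simp add: R_def r_def)
      then have "(R * s)\<^sup>2 \<le> (g p * S)\<^sup>2"
        using Suc unfolding R_def[symmetric] S_def[symmetric] by (intro power_mono)
      also have "\<dots> \<le> (s * g (Suc p)) * S\<^sup>2"
        unfolding power_mult_distrib by (intro mult_right_mono g_sq) simp
      finally have "s * (R\<^sup>2 * s) \<le> s * (g (Suc p) * S\<^sup>2)"
        by (simp add: power2_eq_square algebra_simps)
      then have "R\<^sup>2 * s \<le> g (Suc p) * S\<^sup>2" using s by simp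
      then show ?case by (simp add: R_def S_def mult.commute flip: power_mult)
    qed
    \<comment> \<open>\<open>Q_le\<close> does not apply to \<open>x\<close>, which may lie outside
      \<open>B\<close>. Taking adjoints moves \<open>Q p\<close> to the right, where it acts on
      \<open>\<one>\<close>, an element of \<open>B\<close>; the cost is the constant
      \<open>C\<close>, independent of \<open>p\<close>.\<close>
    have g_le: "g p \<le> (K\<^sup>2) ^ 2 ^ p * C" for p
    proof -
      have "g p = norm2 (adj (Q p \<otimes> x))" using x by (simp add: g_def norm2_adj)
      also have "\<dots> = norm2 (adj x \<otimes> Q p)" using x by (simp add: adj_mult)
      also have "\<dots> \<le> nrm (adj x) * norm2 (Q p \<otimes> \<one>)" using x norm2_mult_le[of "adj x" "Q p"] by simp
      also have "\<dots> \<le> nrm (adj x) * ((K\<^sup>2) ^ 2 ^ p * norm2 \<one>)"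
        using x by (intro mult_left_mono Q_le nrm_nonneg) auto
      finally show ?thesis by (simp add: C_def algebra_simps)
    qed
    have "r ^ 2 ^ p * s \<le> (K\<^sup>2 * s\<^sup>2) ^ 2 ^ p * C" for p
    proof -
      have "g p * (s\<^sup>2) ^ 2 ^ p \<le> ((K\<^sup>2) ^ 2 ^ p * C) * (s\<^sup>2) ^ 2 ^ p"
        using g_le[of p] by (intro mult_right_mono) auto
      then show ?thesis using r_pow[of p] by (simp add: power_mult_distrib algebra_simps)
    qed
    from le_of_power_le_mult[OF _ s this] have "r \<le> (K * s)\<^sup>2" by (simp add: power_mult_distrib)
    then have "norm2 (c \<otimes> x) \<le> K * s"
      unfolding r_def by (rule power2_le_imp_le) (use K s in simp)
    then show ?thesis by (simp add: s_def)
  qed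
qed (use c K in simp_all)

lemma orthogonal_projection_contractive:
  assumes E_sub: "\<And>a. a \<in> carrier M \<Longrightarrow> E a \<in> B"
    and E_ip: "\<And>a b. a \<in> carrier M \<Longrightarrow> b \<in> B \<Longrightarrow> ip (E a) b = ip a b"
    and a: "a \<in> carrier M"
  shows "nrm (E a) \<le> nrm a"
proof (rule nrm_le_on_sub)
  fix x assume x: "x \<in> B"
  \<comment> \<open>Right multiplication by \<open>x\<close> is moved to the test vector, and
    \<open>b \<otimes> adj x\<close> is still in \<open>B\<close>. This lets the contraction
    \<open>E\<close> for \<open>norm2\<close> act on \<open>a \<otimes> x\<close>.\<close>
  have "E (a \<otimes> x) = E a \<otimes> x"
  proof (rule sub_eqI)
    fix b assume b: "b \<in> B"
    have "ip (E (a \<otimes> x)) b = ip a (b \<otimes> adj x)" using a b x by (simp add: E_ip ip_mult_right)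
    also have "\<dots> = ip (E a \<otimes> x) b" using a b x by (simp add: E_ip E_sub ip_mult_right)
    finally show "ip (E (a \<otimes> x)) b = ip (E a \<otimes> x) b" .
  qed (use a x E_sub in simp_all)
  moreover have "norm2 (E y) \<le> norm2 y" if y: "y \<in> carrier M" for y
  proof (cases "norm2 (E y) = 0")
    case True
    then show ?thesis using y by simp
  next
    case False
    then have pos: "0 < norm2 (E y)" using E_sub[OF y] by (simp add: less_le)
    have "(norm2 (E y))\<^sup>2 = Re (ip y (E y))" using y E_sub[OF y] by (simp add: norm2_sq E_ip)
    also have "\<dots> \<le> norm2 y * norm2 (E y)"
      using Cauchy_Schwarz[of y "E y"] complex_Re_le_cmod[of "ip y (E y)"] y E_sub[OF y] by simp
    finally show ?thesis using pos by (simp add: power2_eq_square)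
  qed
  ultimately have "norm2 (E a \<otimes> x) \<le> norm2 (a \<otimes> x)"
    using a x by (metis m_closed sub_closed)
  also have "\<dots> \<le> nrm a * norm2 x" using a x by (simp add: norm2_mult_le)
  finally show "norm2 (E a \<otimes> x) \<le> nrm a * norm2 x" .
qed (use a E_sub nrm_nonneg in simp_all)

text \<open>A map that fixes \<open>B\<close> and does not increase \<open>norm2\<close> is an
  orthogonal projection. Contractivity concerns \<open>nrm\<close>, so the \<open>norm2\<close>
  estimate is first extracted for self-adjoint elements and then extended by complex
  linearity.\<close>

lemma trace_preserving_contraction_orthogonal:
  assumes P_sub: "\<And>a. a \<in> carrier M \<Longrightarrow> P a \<in> B"
    and P_add: "\<And>a b. a \<in> carrier M \<Longrightarrow> b \<in> carrier M \<Longrightarrow> P (a \<oplus> b) = P a \<oplus> P b"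
    and P_smult: "\<And>c a. a \<in> carrier M \<Longrightarrow> P (c \<odot> a) = c \<odot> P a"
    and P_fix: "\<And>b. b \<in> B \<Longrightarrow> P b = b"
    and P_nrm: "\<And>a. a \<in> carrier M \<Longrightarrow> nrm (P a) \<le> nrm a"
    and P_tr: "\<And>a. a \<in> carrier M \<Longrightarrow> tr (P a) = tr a"
    and a: "a \<in> carrier M" and b: "b \<in> B"
  shows "ip (P a) b = ip a b"
proof -
  have P_carrier [simp]: "P a \<in> carrier M" if "a \<in> carrier M" for a
    using P_sub that by simp
  have P_one [simp]: "P \<one> = \<one>" by (simp add: P_fix)
  \<comment> \<open>Contractivity in quadratic form: squared norms turn the later perturbation
    estimates into polynomial inequalities in \<open>t\<close>.\<close>
  have P_bound: "(norm2 (P u \<otimes> y))\<^sup>2 \<le> D * (norm2 y)\<^sup>2"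
    if u: "u \<in> carrier M" and y: "y \<in> carrier M" and "0 \<le> D"
      and bd: "\<And>z. z \<in> carrier M \<Longrightarrow> (norm2 (u \<otimes> z))\<^sup>2 \<le> D * (norm2 z)\<^sup>2" for u y D
  proof -
    have "nrm u \<le> sqrt D"
    proof (rule nrm_le[OF u])
      fix z assume z: "z \<in> carrier M"
      have "norm2 (u \<otimes> z) \<le> sqrt (D * (norm2 z)\<^sup>2)" by (rule real_le_rsqrt[OF bd[OF z]])
      also have "\<dots> = sqrt D * norm2 z" using z by (simp add: real_sqrt_mult)
      finally show "norm2 (u \<otimes> z) \<le> sqrt D * norm2 z" .
    qed (use \<open>0 \<le> D\<close> in simp)
    then have "nrm (P u) \<le> sqrt D" using P_nrm[OF u] by simp
    then have "nrm (P u) * norm2 y \<le> sqrt D * norm2 y" using y by (intro mult_right_mono) auto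
    then have "norm2 (P u \<otimes> y) \<le> sqrt D * norm2 y"
      using norm2_mult_le[of "P u" y] u y by simp
    then have "(norm2 (P u \<otimes> y))\<^sup>2 \<le> (sqrt D * norm2 y)\<^sup>2" using u y by (intro power_mono) auto
    then show ?thesis using \<open>0 \<le> D\<close> by (simp add: power_mult_distrib)
  qed
  have Im_zero: "Im (ip (P x \<otimes> y) y) = 0"
    if x: "x \<in> carrier M" and sa: "adj x = x" and y: "y \<in> carrier M" for x y
  proof (rule zero_of_mult_le_square)
    fix t :: real
    \<comment> \<open>Being purely imaginary, \<theta> gives no first-order term before
      \<open>P\<close> is applied. The factor 1/2 makes the cross term after \<open>P\<close>
      exactly \<open>t * Im (ip (P x \<otimes> y) y)\<close>.\<close>
    define \<theta> where "\<theta> = - \<i> * complex_of_real (t / 2)"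
    define D where "D = 1 + (t / 2)\<^sup>2 * (nrm x)\<^sup>2"
    have D: "0 \<le> D" by (simp add: D_def)
    have \<theta>: "(cmod \<theta>)\<^sup>2 = (t / 2)\<^sup>2" by (simp add: \<theta>_def norm_mult power_divide)
    have "(norm2 ((\<one> \<oplus> \<theta> \<odot> x) \<otimes> z))\<^sup>2 \<le> D * (norm2 z)\<^sup>2" if z: "z \<in> carrier M" for z
    proof -
      have "(norm2 ((\<one> \<oplus> \<theta> \<odot> x) \<otimes> z))\<^sup>2 = (norm2 z)\<^sup>2 + (t / 2)\<^sup>2 * (norm2 (x \<otimes> z))\<^sup>2"
        using x z Im_ip_self_adjoint[OF x sa z]
        by (simp add: l_distr smult_mult_left norm2_sq_add norm2_sq_smult \<theta>) (simp add: \<theta>_def)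
      also have "\<dots> \<le> (norm2 z)\<^sup>2 + (t / 2)\<^sup>2 * (nrm x * norm2 z)\<^sup>2"
        using x z norm2_mult_le[of x z] by (intro add_left_mono mult_left_mono power_mono) auto
      finally show ?thesis by (simp add: D_def algebra_simps power_mult_distrib)
    qed
    from P_bound[OF _ y D this] have "(norm2 (P (\<one> \<oplus> \<theta> \<odot> x) \<otimes> y))\<^sup>2 \<le> D * (norm2 y)\<^sup>2" using x by simp
    also have "P (\<one> \<oplus> \<theta> \<odot> x) \<otimes> y = y \<oplus> \<theta> \<odot> (P x \<otimes> y)"
      using x y by (simp add: P_add P_smult l_distr smult_mult_left)
    also have "(norm2 \<dots>)\<^sup>2 = (norm2 y)\<^sup>2 + (t / 2)\<^sup>2 * (norm2 (P x \<otimes> y))\<^sup>2 + 2 * Re (cnj \<theta> * ip y (P x \<otimes> y))"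
      using x y by (simp add: norm2_sq_add norm2_sq_smult \<theta>)
    also have "2 * Re (cnj \<theta> * ip y (P x \<otimes> y)) = t * Im (ip (P x \<otimes> y) y)"
    proof -
      have "Im (ip y (P x \<otimes> y)) = - Im (ip (P x \<otimes> y) y)"
        using cnj_ip[of "P x \<otimes> y" y] x y by (metis cnj.simps(2) P_carrier m_closed)
      then show ?thesis by (simp add: \<theta>_def)
    qed
    finally have "t * Im (ip (P x \<otimes> y) y) \<le> (D - 1) * (norm2 y)\<^sup>2 - (t / 2)\<^sup>2 * (norm2 (P x \<otimes> y))\<^sup>2"
      by (simp add: algebra_simps)
    also have "\<dots> \<le> (D - 1) * (norm2 y)\<^sup>2" by simp
    finally show "t * Im (ip (P x \<otimes> y) y) \<le> t\<^sup>2 * ((nrm x)\<^sup>2 / 4 * (norm2 y)\<^sup>2)"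
      by (simp add: D_def power_divide)
  qed
  have P_norm2: "norm2 (P x) \<le> norm2 x" if x: "x \<in> carrier M" and sa: "adj x = x" for x
  proof -
    define k where "k = nrm x"
    define w where "w = P (x \<otimes> x)"
    have k: "0 \<le> k" using x by (simp add: k_def nrm_nonneg)
    have w: "w \<in> carrier M" using x by (simp add: w_def)
    have "(norm2 (P x))\<^sup>2 - (norm2 x)\<^sup>2 \<le> 0"
    proof (rule nonpos_of_square_mult_le)
      fix t :: real
      assume "0 < t"
      define \<theta> where "\<theta> = \<i> * complex_of_real t"
      define \<eta> where "\<eta> = - complex_of_real (t\<^sup>2 / 2)"
      \<comment> \<open>The second Taylor polynomial of exp (i t x). Here
        \<open>adj u \<otimes> u\<close> is 1 + t^4 x^4 / 4, so \<open>D\<close> differs from 1 only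
        in order \<open>t ^ 4\<close>.\<close>
      define u where "u = \<one> \<oplus> (\<theta> \<odot> x \<oplus> \<eta> \<odot> (x \<otimes> x))"
      define D where "D = 1 + t ^ 4 / 4 * k ^ 4"
      have D: "0 \<le> D" by (simp add: D_def)
      have \<theta>: "(cmod \<theta>)\<^sup>2 = t\<^sup>2" by (simp add: \<theta>_def norm_mult)
      have \<eta>: "(cmod \<eta>)\<^sup>2 = t ^ 4 / 4" by (simp add: \<eta>_def norm_mult norm_divide norm_power power_divide flip: power_mult)
      have u: "u \<in> carrier M" using x by (simp add: u_def)
      have "(norm2 (u \<otimes> z))\<^sup>2 \<le> D * (norm2 z)\<^sup>2" if z: "z \<in> carrier M" for z
      proof -
        define xz where "xz = x \<otimes> z"
        have xz: "xz \<in> carrier M" using x z by (simp add: xz_def)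
        have uz: "u \<otimes> z = z \<oplus> (\<theta> \<odot> xz \<oplus> \<eta> \<odot> (x \<otimes> xz))"
          using x z by (simp add: u_def xz_def l_distr smult_mult_left m_assoc)
        have i1: "Im (ip z xz) = 0" "Im (ip xz (x \<otimes> xz)) = 0"
          using Im_ip_self_adjoint[OF x sa] z xz by (simp_all add: xz_def)
        have i2: "ip z (x \<otimes> xz) = complex_of_real ((norm2 xz)\<^sup>2)"
          using ip_mult_left[of x z xz] x z sa xz by (simp add: ip_self flip: xz_def)
        \<comment> \<open>The square of the first-order term cancels against the cross term of
          \<open>z\<close> with the second-order term; the odd cross terms vanish because
          \<open>x\<close> is self-adjoint.\<close>
        have "(norm2 (u \<otimes> z))\<^sup>2 = (norm2 z)\<^sup>2 + t ^ 4 / 4 * (norm2 (x \<otimes> xz))\<^sup>2"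
          unfolding uz using x z xz i1
          by (simp add: norm2_sq_add norm2_sq_smult \<theta> \<eta> i2) (simp add: \<theta>_def \<eta>_def)
        also have "\<dots> \<le> (norm2 z)\<^sup>2 + t ^ 4 / 4 * (k * (k * norm2 z))\<^sup>2"
        proof -
          have "norm2 (x \<otimes> xz) \<le> k * norm2 xz" "norm2 xz \<le> k * norm2 z"
            unfolding k_def xz_def using x z by (simp_all add: norm2_mult_le)
          then have "norm2 (x \<otimes> xz) \<le> k * (k * norm2 z)"
            using k by (meson mult_left_mono order_trans)
          then show ?thesis using x xz by (intro add_left_mono mult_left_mono power_mono) auto
        qed
        also have "\<dots> = D * (norm2 z)\<^sup>2"
          by (simp add: D_def power_mult_distrib power2_eq_square power4_eq_xxxx algebra_simps)
        finally show ?thesis .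
      qed
      from P_bound[OF u _ D this, of \<one>] have "(norm2 (P u))\<^sup>2 \<le> D * (norm2 \<one>)\<^sup>2" using u by simp
      moreover have "P u = \<one> \<oplus> (\<theta> \<odot> P x \<oplus> \<eta> \<odot> w)"
        using x by (simp add: u_def P_add P_smult w_def)
      \<comment> \<open>Trace preservation is used twice: \<open>tr (P x) = tr x\<close> is real,
        which kills the term in \<open>t\<close>, and \<open>tr w = tr (x \<otimes> x)\<close> puts
        \<open>norm2 x\<close> beside \<open>norm2 (P x)\<close> in order
        \<open>t\<^sup>2\<close>.\<close>
      moreover have "(norm2 (\<one> \<oplus> (\<theta> \<odot> P x \<oplus> \<eta> \<odot> w)))\<^sup>2 =
        (norm2 \<one>)\<^sup>2 + t\<^sup>2 * (norm2 (P x))\<^sup>2 + t ^ 4 / 4 * (norm2 w)\<^sup>2 - t\<^sup>2 * (norm2 x)\<^sup>2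
        + t ^ 3 * Im (ip (P x) w)"
      proof -
        have "ip (P x) \<one> = ip x \<one>" using x P_tr[of x] by (simp flip: tr_eq_ip)
        moreover have "cnj (ip x \<one>) = ip x \<one>"
          using x sa tr_adj[of x] by (simp flip: tr_eq_ip)
        ultimately have "cnj (ip \<one> (P x)) = ip \<one> (P x)" using x by (simp add: cnj_ip) (metis cnj_ip one_closed P_carrier)
        then have 1: "Im (ip \<one> (P x)) = 0" by (metis cnj.simps(2) equal_neg_zero)
        have "ip w \<one> = ip x x" using x P_tr[of "x \<otimes> x"] sa by (simp add: w_def ip_mult_left flip: tr_eq_ip) (simp add: ip_def)
        then have 2: "ip \<one> w = complex_of_real ((norm2 x)\<^sup>2)"
          using cnj_ip[of w \<one>] w x by (simp add: ip_self)
        show ?thesis using x w 1 2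
          by (simp add: norm2_sq_add norm2_sq_smult \<theta> \<eta>)
            (simp add: \<theta>_def \<eta>_def power2_eq_square power3_eq_cube)
      qed
      ultimately have "t\<^sup>2 * (norm2 (P x))\<^sup>2 + t ^ 4 / 4 * (norm2 w)\<^sup>2 - t\<^sup>2 * (norm2 x)\<^sup>2 + t ^ 3 * Im (ip (P x) w)
        \<le> t ^ 4 / 4 * k ^ 4 * (norm2 \<one>)\<^sup>2"
        by (simp add: D_def algebra_simps)
      moreover have "0 \<le> t ^ 4 / 4 * (norm2 w)\<^sup>2" by simp
      ultimately have "t\<^sup>2 * (norm2 (P x))\<^sup>2 - t\<^sup>2 * (norm2 x)\<^sup>2 + t ^ 3 * Im (ip (P x) w)
        \<le> t ^ 4 / 4 * k ^ 4 * (norm2 \<one>)\<^sup>2"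
        by linarith
      then show "t\<^sup>2 * ((norm2 (P x))\<^sup>2 - (norm2 x)\<^sup>2)
        \<le> t ^ 4 * (k ^ 4 / 4 * (norm2 \<one>)\<^sup>2) + t ^ 3 * (- Im (ip (P x) w))"
        by (simp add: algebra_simps)
    qed
    then show ?thesis using x by (simp add: abs_le_square_iff[symmetric])
  qed
  have self_adjoint: "ip (P x) y = ip x y"
    if x: "x \<in> carrier M" and sax: "adj x = x" and y: "y \<in> B" and say: "adj y = y" for x y
  proof (rule complex_eqI)
    have "Re (ip (P x) y) - Re (ip x y) = 0"
    \<comment> \<open>Since \<open>P\<close> fixes \<open>y\<close>, adding a real multiple of
      \<open>y\<close> adds the same quadratic term on both sides of the \<open>norm2\<close>
      estimate, leaving an inequality affine in \<open>s\<close>.\<close>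
    proof (rule slope_zero_of_bounded)
      fix s :: real
      define c where "c = complex_of_real (s / 2)"
      have "(norm2 (P (x \<oplus> c \<odot> y)))\<^sup>2 \<le> (norm2 (x \<oplus> c \<odot> y))\<^sup>2"
        using x y sax say by (intro power_mono P_norm2) (simp_all add: adj_add adj_smult c_def)
      then show "s * (Re (ip (P x) y) - Re (ip x y)) \<le> (norm2 x)\<^sup>2 - (norm2 (P x))\<^sup>2"
        using x y by (simp add: P_add P_smult P_fix norm2_sq_add norm2_sq_smult) (simp add: c_def algebra_simps)
    qed
    then show "Re (ip (P x) y) = Re (ip x y)" by simp
    \<comment> \<open>Polarisation between \<open>\<one>\<close> and \<open>y\<close>: once the two
      diagonal terms are removed, both mixed terms equal \<open>ip (P x) y\<close>.\<close>
    have "Im (ip (P x \<otimes> (\<one> \<oplus> y)) (\<one> \<oplus> y)) = 0" "Im (ip (P x \<otimes> y) y) = 0" "Im (ip (P x \<otimes> \<one>) \<one>) = 0"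
      using x y sax by (intro Im_zero; simp)+
    moreover have "ip (P x \<otimes> y) \<one> = ip (P x) y"
      using x y say by (simp add: ip_mult_right)
    ultimately have "Im (ip (P x) y) = 0" using x y by (simp add: r_distr)
    moreover have "cnj (ip x y) = ip x y"
      using x y sax say tr_mult_commute[of y x] by (simp add: cnj_ip) (simp add: ip_def)
    then have "Im (ip x y) = 0" by (metis cnj.simps(2) equal_neg_zero)
    ultimately show "Im (ip (P x) y) = Im (ip x y)" by simp
  qed
  define re where "re x = (1/2) \<odot> (x \<oplus> adj x)" for x
  define im where "im x = (\<i>/2) \<odot> (adj x \<oplus> (- 1) \<odot> x)" for x
  have closed [simp]: "x \<in> carrier M \<Longrightarrow> re x \<in> carrier M" "x \<in> carrier M \<Longrightarrow> im x \<in> carrier M"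
    "x \<in> B \<Longrightarrow> re x \<in> B" "x \<in> B \<Longrightarrow> im x \<in> B" for x
    by (simp_all add: re_def im_def)
  have sa [simp]: "adj (re x) = re x" "adj (im x) = im x" if "x \<in> carrier M" for x
  proof -
    show "adj (re x) = re x" using that by (simp add: re_def adj_smult adj_add a_comm)
    show "adj (im x) = im x"
      using that smult_r_distr[of "- \<i> / 2" x "- 1 \<odot> adj x"] smult_r_distr[of "\<i> / 2" "adj x" "- 1 \<odot> x"]
      by (simp add: im_def adj_smult adj_add smult_smult a_comm)
  qed
  have dec: "x = re x \<oplus> \<i> \<odot> im x" if "x \<in> carrier M" for x
    unfolding re_def im_def by (rule self_adjoint_decomposition[OF that])
  have "ip (P (re a \<oplus> \<i> \<odot> im a)) (re b \<oplus> \<i> \<odot> im b) = ip (re a \<oplus> \<i> \<odot> im a) (re b \<oplus> \<i> \<odot> im b)"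
    using a b by (simp add: P_add P_smult self_adjoint)
  then show ?thesis using dec[OF a] dec[of b] b by simp
qed

section \<open>The orthogonal projection as the unique expectation\<close>

lemma sub_zero [simp]: "\<zero> \<in> B"
proof -
  have "0 \<odot> \<one> = \<zero>" using lmult_0[of \<one>] by simp
  then show ?thesis using sub_smult[OF sub_one, of 0] by metis
qed

lemma sub_finsum:
  assumes "f \<in> S \<rightarrow> B"
  shows "finsum M f S \<in> B"
  using assms by (induction S rule: infinite_finite_induct) (auto simp: Pi_iff)

lemma sub_submodule: "submodule class_ring B M"
  by (rule submodule.intro) (use sub_carrier module_axioms in auto)

lemma sub_vectorspace: "vectorspace class_ring (M\<lparr>carrier := B\<rparr>)"
  using submodule_is_module[OF sub_submodule] by (simp add: vectorspace_def class_field)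

lemma ip_eq_on_span:
  assumes gen: "module.span class_ring (M\<lparr>carrier := B\<rparr>) \<beta> = B" and sub: "\<beta> \<subseteq> B"
    and x: "x \<in> carrier M" and y: "y \<in> carrier M"
    and eq: "\<And>b. b \<in> \<beta> \<Longrightarrow> ip x b = ip y b" and b: "b \<in> B"
  shows "ip x b = ip y b"
proof -
  interpret V: vectorspace class_ring "M\<lparr>carrier := B\<rparr>" by (rule sub_vectorspace)
  have "submodule class_ring {b \<in> B. ip x b = ip y b} (M\<lparr>carrier := B\<rparr>)"
  proof (rule submodule.intro)
    show "module class_ring (M\<lparr>carrier := B\<rparr>)" by (rule V.module_axioms)
    have "ip x \<zero> = 0" if "x \<in> carrier M" for x using cnj_ip[of \<zero> x] that by simp
    then show "\<zero>\<^bsub>M\<lparr>carrier := B\<rparr>\<^esub> \<in> {b \<in> B. ip x b = ip y b}" using x y by simp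
  qed (use x y in auto)
  moreover have "\<beta> \<subseteq> {b \<in> B. ip x b = ip y b}" using sub eq by blast
  ultimately have "V.span \<beta> \<subseteq> {b \<in> B. ip x b = ip y b}" by (intro V.span_is_subset)
  then show ?thesis using gen b by blast
qed

text \<open>Everything follows by testing against \<open>B\<close>; trace preservation is the test
  against \<open>\<one>\<close>.\<close>

lemma orthogonal_projection_expectation:
  assumes E_sub: "\<And>a. a \<in> carrier M \<Longrightarrow> E a \<in> B"
    and E_ip: "\<And>a b. a \<in> carrier M \<Longrightarrow> b \<in> B \<Longrightarrow> ip (E a) b = ip a b"
  shows "linear_map class_ring M (M\<lparr>carrier := B\<rparr>) E"
    and "\<And>b. b \<in> B \<Longrightarrow> E b = b"
    and "\<And>a. a \<in> carrier M \<Longrightarrow> tr (E a) = tr a"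
proof -
  interpret V: vectorspace class_ring "M\<lparr>carrier := B\<rparr>" by (rule sub_vectorspace)
  have "E (a \<oplus> b) = E a \<oplus> E b" if "a \<in> carrier M" "b \<in> carrier M" for a b
    using that by (intro sub_eqI) (auto simp: E_sub E_ip)
  moreover have "E (c \<odot> a) = c \<odot> E a" if "a \<in> carrier M" for c a
    using that by (intro sub_eqI) (auto simp: E_sub E_ip)
  ultimately have "E \<in> module_hom class_ring M (M\<lparr>carrier := B\<rparr>)"
    by (auto simp: module_hom_def E_sub)
  then have "mod_hom class_ring M (M\<lparr>carrier := B\<rparr>) E"
    by (intro mod_hom.intro module_axioms V.module_axioms mod_hom_axioms.intro)
  then show "linear_map class_ring M (M\<lparr>carrier := B\<rparr>) E"
    by (intro linear_map.intro V.vectorspace_axioms) (auto simp: vectorspace_def class_field module_axioms)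
  show "E b = b" if "b \<in> B" for b
    using that by (intro sub_eqI) (auto simp: E_sub E_ip)
  show "tr (E a) = tr a" if "a \<in> carrier M" for a
    using that E_ip[of a \<one>] by (simp add: tr_eq_ip E_sub)
qed

text \<open>Existence is contractivity of the projection, uniqueness its converse. The predicate is
  spelled out so that it matches \<open>cond_exp\<close> after unfolding.\<close>

lemma the_trace_preserving_expectation:
  assumes E_sub: "\<And>a. a \<in> carrier M \<Longrightarrow> E a \<in> B"
    and E_ip: "\<And>a b. a \<in> carrier M \<Longrightarrow> b \<in> B \<Longrightarrow> ip (E a) b = ip a b"
    and a: "a \<in> carrier M"
  shows "(THE P. P \<in> extensional (carrier M) \<and>
    (linear_map class_ring M (M\<lparr>carrier := B\<rparr>) P \<and> (\<forall>b\<in>B. P b = b) \<and> (\<forall>a\<in>carrier M. nrm (P a) \<le> nrm a)) \<and>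
    (\<forall>a\<in>carrier M. tr (P a) = tr a)) a = E a"
proof -
  \<comment> \<open>\<open>E\<close> is arbitrary off the carrier, while the described map has to be
    extensional.\<close>
  define F where "F = restrict E (carrier M)"
  have F_sub: "F a \<in> B" if "a \<in> carrier M" for a using that E_sub by (simp add: F_def)
  have F_ip: "ip (F a) b = ip a b" if "a \<in> carrier M" "b \<in> B" for a b using that E_ip by (simp add: F_def)
  have "(THE P. P \<in> extensional (carrier M) \<and>
    (linear_map class_ring M (M\<lparr>carrier := B\<rparr>) P \<and> (\<forall>b\<in>B. P b = b) \<and> (\<forall>a\<in>carrier M. nrm (P a) \<le> nrm a)) \<and>
    (\<forall>a\<in>carrier M. tr (P a) = tr a)) = F"
  proof (rule the_equality, intro conjI ballI)
    show "F \<in> extensional (carrier M)" by (simp add: F_def)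
  next
    fix P
    assume P: "P \<in> extensional (carrier M) \<and>
      (linear_map class_ring M (M\<lparr>carrier := B\<rparr>) P \<and> (\<forall>b\<in>B. P b = b) \<and> (\<forall>a\<in>carrier M. nrm (P a) \<le> nrm a)) \<and>
      (\<forall>a\<in>carrier M. tr (P a) = tr a)"
    then interpret P: linear_map class_ring M "M\<lparr>carrier := B\<rparr>" P by blast
    have P_sub: "P a \<in> B" if "a \<in> carrier M" for a using P.f_im[OF that] by simp
    have P_ip: "ip (P a) b = ip a b" if "a \<in> carrier M" "b \<in> B" for a b
    proof (rule trace_preserving_contraction_orthogonal)
      show "P (a \<oplus> b) = P a \<oplus> P b" if "a \<in> carrier M" "b \<in> carrier M" for a b
        using P.f_add[OF that] by simp
      show "P (c \<odot> a) = c \<odot> P a" if "a \<in> carrier M" for c a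
        using P.f_smult[OF _ that, of c] by simp
    qed (use that P P_sub in auto)
    show "P = F"
    proof (rule extensionalityI)
      show "P x = F x" if "x \<in> carrier M" for x
        using that by (intro sub_eqI) (simp_all add: P_sub P_ip F_sub F_ip)
    qed (use P in \<open>simp_all add: F_def\<close>)
  qed (use orthogonal_projection_expectation[of F, OF F_sub F_ip]
      orthogonal_projection_contractive[of F, OF F_sub F_ip] in auto)
  then show ?thesis using a by (simp add: F_def)
qed

text \<open>The Fourier expansion in an orthogonal basis has the right inner products with the
  basis, hence with its span \<open>B\<close>.\<close>

lemma the_trace_preserving_expectation_basis:
  assumes fin: "finite \<beta>" and sub: "\<beta> \<subseteq> B"
    and gen: "module.span class_ring (M\<lparr>carrier := B\<rparr>) \<beta> = B"
    and orth: "\<And>x y. x \<in> \<beta> \<Longrightarrow> y \<in> \<beta> \<Longrightarrow> x \<noteq> y \<Longrightarrow> ip x y = 0"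
    and nonzero: "\<zero> \<notin> \<beta>" and a: "a \<in> carrier M"
  shows "(THE P. P \<in> extensional (carrier M) \<and>
    (linear_map class_ring M (M\<lparr>carrier := B\<rparr>) P \<and> (\<forall>b\<in>B. P b = b) \<and> (\<forall>a\<in>carrier M. nrm (P a) \<le> nrm a)) \<and>
    (\<forall>a\<in>carrier M. tr (P a) = tr a)) a = (\<Oplus>b\<in>\<beta>. (ip a b / ip b b) \<odot> b)"
proof (rule the_trace_preserving_expectation[OF _ _ a])
  fix a assume a: "a \<in> carrier M"
  show E_sub: "(\<Oplus>b\<in>\<beta>. (ip a b / ip b b) \<odot> b) \<in> B"
    using sub by (intro sub_finsum) auto
  show "ip (\<Oplus>b\<in>\<beta>. (ip a b / ip b b) \<odot> b) c = ip a c" if c: "c \<in> B" for c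
  proof (rule ip_eq_on_span[OF gen sub _ a _ c])
    fix c assume c: "c \<in> \<beta>"
    then have "ip c c \<noteq> 0" using nonzero tr_faithful[of c] sub by (auto simp: ip_def)
    have "ip (\<Oplus>b\<in>\<beta>. (ip a b / ip b b) \<odot> b) c = (\<Sum>b\<in>\<beta>. ip a b / ip b b * ip b c)"
      using c sub sub_carrier by (subst ip_finsum) (auto simp: subset_iff intro!: sum.cong)
    also have "\<dots> = (\<Sum>b\<in>\<beta>. if b = c then ip a c else 0)"
      using c orth \<open>ip c c \<noteq> 0\<close> by (intro sum.cong) auto
    also have "\<dots> = ip a c" using c fin by simp
    finally show "ip (\<Oplus>b\<in>\<beta>. (ip a b / ip b b) \<odot> b) c = ip a c" .
  qed (use E_sub in simp)
qed

end

subsection \<open>Direct sums of matrix algebras\<close>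

text \<open>Keeps index sets in the form \<open>{1..N}\<close> instead of
  \<open>{Suc 0..N}\<close>.\<close>

declare One_nat_def [simp del]

lemma mem_matrix_sum:
  "x \<in> carrier (matrix_sum N d) \<longleftrightarrow> x \<in> extensional {1..N} \<and> (\<forall>k\<in>{1..N}. x k \<in> carrier_mat (d k) (d k))"
  by (auto simp: matrix_sum_def PiE_def Pi_def)

lemma matrix_sum_component [simp]:
  "k \<in> {1..N} \<Longrightarrow> (x \<oplus>\<^bsub>matrix_sum N d\<^esub> y) k = x k + y k"
  "k \<in> {1..N} \<Longrightarrow> (x \<otimes>\<^bsub>matrix_sum N d\<^esub> y) k = x k * y k"
  "k \<in> {1..N} \<Longrightarrow> (c \<odot>\<^bsub>matrix_sum N d\<^esub> x) k = c \<cdot>\<^sub>m x k"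
  "k \<in> {1..N} \<Longrightarrow> \<zero>\<^bsub>matrix_sum N d\<^esub> k = 0\<^sub>m (d k) (d k)"
  "k \<in> {1..N} \<Longrightarrow> \<one>\<^bsub>matrix_sum N d\<^esub> k = 1\<^sub>m (d k)"
  "k \<in> {1..N} \<Longrightarrow> ds_adjoint N x k = mat_adjoint (x k)"
  by (simp_all add: matrix_sum_def ds_adjoint_def)

lemma matrix_sum_extensional [simp]:
  "x \<oplus>\<^bsub>matrix_sum N d\<^esub> y \<in> extensional {1..N}"
  "x \<otimes>\<^bsub>matrix_sum N d\<^esub> y \<in> extensional {1..N}"
  "c \<odot>\<^bsub>matrix_sum N d\<^esub> x \<in> extensional {1..N}"
  "\<zero>\<^bsub>matrix_sum N d\<^esub> \<in> extensional {1..N}"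
  "\<one>\<^bsub>matrix_sum N d\<^esub> \<in> extensional {1..N}"
  "ds_adjoint N x \<in> extensional {1..N}"
  by (simp_all add: matrix_sum_def ds_adjoint_def)

lemma matrix_sum_carrier_component:
  "x \<in> carrier (matrix_sum N d) \<Longrightarrow> k \<in> {1..N} \<Longrightarrow> x k \<in> carrier_mat (d k) (d k)"
  by (simp add: mem_matrix_sum)

lemma matrix_sum_carrier_extensional [simp]:
  "x \<in> carrier (matrix_sum N d) \<Longrightarrow> x \<in> extensional {1..N}"
  by (simp add: mem_matrix_sum)

lemma matrix_sum_eqI:
  assumes "x \<in> extensional {1..N}" "y \<in> extensional {1..N}" "\<And>k. k \<in> {1..N} \<Longrightarrow> x k = y k"
  shows "x = y"
  using assms by (meson extensionalityI)

section \<open>Adjoint and trace of a single matrix\<close>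

lemma mat_adjoint_dim [simp]:
  "dim_row (mat_adjoint X) = dim_col X" "dim_col (mat_adjoint X) = dim_row X"
  by (simp_all add: mat_adjoint_def)

lemma mat_adjoint_carrier [simp]: "X \<in> carrier_mat m n \<Longrightarrow> mat_adjoint X \<in> carrier_mat n m"
  by auto

lemma mat_adjoint_entry [simp]:
  fixes X :: "complex mat"
  assumes "i < dim_col X" "j < dim_row X"
  shows "mat_adjoint X $$ (i, j) = cnj (X $$ (j, i))"
  using assms by (simp add: mat_adjoint_def mat_of_rows_def)

lemma mult_entry:
  assumes "X \<in> carrier_mat n n" "Y \<in> carrier_mat n n" "i < n" "j < n"
  shows "(X * Y) $$ (i, j) = (\<Sum>l<n. X $$ (i, l) * Y $$ (l, j))"
  using assms by (simp add: scalar_prod_def atLeast0LessThan)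

lemma mat_adjoint_mult:
  fixes X Y :: "complex mat"
  assumes "X \<in> carrier_mat m l" "Y \<in> carrier_mat l n"
  shows "mat_adjoint (X * Y) = mat_adjoint Y * mat_adjoint X"
  using assms by (intro eq_matI) (auto simp: scalar_prod_def mult.commute)

lemma mat_adjoint_adjoint:
  fixes X :: "complex mat"
  shows "mat_adjoint (mat_adjoint X) = X"
  by (intro eq_matI) auto

lemma mat_adjoint_add:
  fixes X Y :: "complex mat"
  assumes "X \<in> carrier_mat m n" "Y \<in> carrier_mat m n"
  shows "mat_adjoint (X + Y) = mat_adjoint X + mat_adjoint Y"
  using assms by (intro eq_matI) auto

lemma mat_adjoint_smult:
  fixes X :: "complex mat"
  shows "mat_adjoint (c \<cdot>\<^sub>m X) = cnj c \<cdot>\<^sub>m mat_adjoint X"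
  by (intro eq_matI) auto

lemma mat_tr_add: "X \<in> carrier_mat n n \<Longrightarrow> Y \<in> carrier_mat n n \<Longrightarrow> mat_tr (X + Y) = mat_tr X + mat_tr Y"
  by (simp add: mat_tr_def sum.distrib)

lemma mat_tr_smult: "X \<in> carrier_mat n n \<Longrightarrow> mat_tr (c \<cdot>\<^sub>m X) = c * mat_tr X"
  by (simp add: mat_tr_def sum_distrib_left)

lemma mat_tr_mult:
  "X \<in> carrier_mat n n \<Longrightarrow> Y \<in> carrier_mat n n \<Longrightarrow> mat_tr (X * Y) = (\<Sum>i<n. \<Sum>l<n. X $$ (i, l) * Y $$ (l, i))"
  by (simp add: mat_tr_def mult_entry[of X n] del: index_mult_mat(1))

lemma mat_tr_mult_commute:
  "X \<in> carrier_mat n n \<Longrightarrow> Y \<in> carrier_mat n n \<Longrightarrow> mat_tr (X * Y) = mat_tr (Y * X)"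
  by (simp only: mat_tr_mult) (subst sum.swap, simp add: mult.commute)

lemma mat_tr_adjoint: "dim_row X = dim_col X \<Longrightarrow> mat_tr (mat_adjoint X) = cnj (mat_tr X)"
  by (simp add: mat_tr_def)

section \<open>The algebraic structure of the direct sum\<close>

lemma ring_matrix_sum: "ring (matrix_sum N d)"
proof -
  let ?M = "matrix_sum N d"
  note mcc = matrix_sum_carrier_component[where N = N and d = d]
  show ?thesis
  proof (rule ringI)
  show "abelian_group ?M"
  proof (rule abelian_groupI)
    fix x assume x: "x \<in> carrier ?M"
    show "\<exists>y\<in>carrier ?M. y \<oplus>\<^bsub>?M\<^esub> x = \<zero>\<^bsub>?M\<^esub>"
    proof (rule bexI[of _ "(- 1) \<odot>\<^bsub>?M\<^esub> x"])
      show "(- 1) \<odot>\<^bsub>?M\<^esub> x \<oplus>\<^bsub>?M\<^esub> x = \<zero>\<^bsub>?M\<^esub>"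
      proof (rule matrix_sum_eqI[where N = N])
        fix k assume k: "k \<in> {1..N}"
        with x have "x k \<in> carrier_mat (d k) (d k)" by (simp add: mem_matrix_sum)
        with k show "((- 1) \<odot>\<^bsub>?M\<^esub> x \<oplus>\<^bsub>?M\<^esub> x) k = \<zero>\<^bsub>?M\<^esub> k"
          by (intro eq_matI) auto
      qed simp_all
      show "(- 1) \<odot>\<^bsub>?M\<^esub> x \<in> carrier ?M" using x by (simp add: mem_matrix_sum)
    qed
  qed (auto intro!: matrix_sum_eqI[where N = N] comm_add_mat[OF mcc mcc] assoc_add_mat[OF mcc mcc mcc]
      simp: mem_matrix_sum[of "_ \<oplus>\<^bsub>?M\<^esub> _"] mem_matrix_sum[of "\<zero>\<^bsub>?M\<^esub>"] left_add_zero_mat[OF mcc] add_carrier_mat[OF mcc]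
      simp del: atLeastAtMost_iff )
  show "Group.monoid ?M"
    by (rule monoidI)
      (auto intro!: matrix_sum_eqI[where N = N] assoc_mult_mat[OF mcc mcc mcc] mult_carrier_mat[OF mcc mcc]
        simp: mem_matrix_sum[of "_ \<otimes>\<^bsub>?M\<^esub> _"] mem_matrix_sum[of "\<one>\<^bsub>?M\<^esub>"] left_mult_one_mat[OF mcc] right_mult_one_mat[OF mcc]
        simp del: atLeastAtMost_iff)
qed (auto intro!: matrix_sum_eqI[where N = N] add_mult_distrib_mat[OF mcc mcc mcc] mult_add_distrib_mat[OF mcc mcc mcc]
      simp del: atLeastAtMost_iff)
qed

lemma vectorspace_matrix_sum: "vectorspace class_ring (matrix_sum N d)"
proof -
  interpret ring "matrix_sum N d" by (rule ring_matrix_sum)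
  note mcc = matrix_sum_carrier_component[where N = N and d = d]
  have "module class_ring (matrix_sum N d)"
    by (rule moduleI)
      (auto intro!: matrix_sum_eqI[where N = N] add_smult_distrib_right_mat[OF mcc] add_smult_distrib_left_mat[OF mcc mcc]
        smult_carrier_mat[OF mcc]
        simp: mem_matrix_sum[of "_ \<odot>\<^bsub>matrix_sum N d\<^esub> _"] class_cring.is_cring abelian_group_axioms
        simp del: atLeastAtMost_iff)
  then show ?thesis by (simp add: vectorspace_def class_field)
qed

text \<open>The trace form is a weighted Hilbert-Schmidt inner product; positivity, faithfulness and
  the final coefficients are read off from these entries.\<close>

lemma tau_adjoint_mult:
  assumes "x \<in> carrier (matrix_sum N d)" "y \<in> carrier (matrix_sum N d)"
  shows "tau N d v (ds_adjoint N y \<otimes>\<^bsub>matrix_sum N d\<^esub> x) =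
    (\<Sum>k=1..N. complex_of_real (v k / real (d k)) * (\<Sum>j<d k. \<Sum>i<d k. cnj (y k $$ (i, j)) * x k $$ (i, j)))"
  unfolding tau_def
proof (intro sum.cong refl arg_cong2[of _ _ _ _ "(*)"])
  fix k assume k: "k \<in> {1..N}"
  then have "x k \<in> carrier_mat (d k) (d k)" "y k \<in> carrier_mat (d k) (d k)"
    using assms by (simp_all add: mem_matrix_sum)
  with k show "mat_tr ((ds_adjoint N y \<otimes>\<^bsub>matrix_sum N d\<^esub> x) k) =
      (\<Sum>j<d k. \<Sum>i<d k. cnj (y k $$ (i, j)) * x k $$ (i, j))"
    by (simp add: mat_tr_mult[of _ "d k"])
qed

lemma tau_adjoint_mult_self:
  assumes "x \<in> carrier (matrix_sum N d)"
  shows "tau N d v (ds_adjoint N x \<otimes>\<^bsub>matrix_sum N d\<^esub> x) =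
    complex_of_real (\<Sum>k=1..N. v k / real (d k) * (\<Sum>j<d k. \<Sum>i<d k. (cmod (x k $$ (i, j)))\<^sup>2))"
  unfolding tau_adjoint_mult[OF assms assms]
  by (simp add: mult.commute flip: complex_norm_square)

lemma tracial_star_algebra_matrix_sum:
  assumes d: "\<And>k. k \<in> {1..N} \<Longrightarrow> 1 \<le> d k" and v: "\<And>k. k \<in> {1..N} \<Longrightarrow> 0 < v k"
  shows "tracial_star_algebra (matrix_sum N d) (ds_adjoint N) (tau N d v)"
proof -
  let ?M = "matrix_sum N d"
  interpret vectorspace class_ring ?M by (rule vectorspace_matrix_sum)
  interpret ring ?M by (rule ring_matrix_sum)
  have w: "0 < v k / real (d k)" if "k \<in> {1..N}" for k
    using d[OF that] v[OF that] by simp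
  show ?thesis
  proof
    fix x y :: "nat \<Rightarrow> complex mat" and c :: complex
    assume x: "x \<in> carrier ?M"
    let ?s = "\<lambda>k. \<Sum>j<d k. \<Sum>i<d k. (cmod (x k $$ (i, j)))\<^sup>2"
    note xk = matrix_sum_carrier_component[OF x]
    show "ds_adjoint N x \<in> carrier ?M" using x by (simp add: mem_matrix_sum)
    show "ds_adjoint N (ds_adjoint N x) = x"
      using x by (intro matrix_sum_eqI[where N = N]) (simp_all add: mat_adjoint_adjoint)
    show "ds_adjoint N (c \<odot>\<^bsub>?M\<^esub> x) = cnj c \<odot>\<^bsub>?M\<^esub> ds_adjoint N x"
      by (intro matrix_sum_eqI[where N = N]) (simp_all add: mat_adjoint_smult)
    show "tau N d v (c \<odot>\<^bsub>?M\<^esub> x) = c * tau N d v x"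
      by (simp add: tau_def mat_tr_smult[OF xk] sum_distrib_left mult.left_commute)
    have "dim_row (x k) = dim_col (x k)" if "k \<in> {1..N}" for k
      using xk[OF that] by simp
    then show "tau N d v (ds_adjoint N x) = cnj (tau N d v x)"
      by (simp add: tau_def mat_tr_adjoint)
    show "0 \<le> Re (tau N d v (ds_adjoint N x \<otimes>\<^bsub>?M\<^esub> x))"
      unfolding tau_adjoint_mult_self[OF x] Re_complex_of_real
      using w by (intro sum_nonneg mult_nonneg_nonneg) (auto simp: less_imp_le)
    show "x = \<zero>\<^bsub>?M\<^esub>" if "tau N d v (ds_adjoint N x \<otimes>\<^bsub>?M\<^esub> x) = 0"
    proof (rule matrix_sum_eqI[where N = N])
      have "(\<Sum>k=1..N. v k / real (d k) * ?s k) = 0"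
        using that unfolding tau_adjoint_mult_self[OF x] of_real_eq_0_iff .
      moreover have "0 \<le> v k / real (d k) * ?s k" if "k \<in> {1..N}" for k
        using w[OF that] by (intro mult_nonneg_nonneg sum_nonneg) (auto simp: less_imp_le)
      ultimately have "\<forall>k\<in>{1..N}. v k / real (d k) * ?s k = 0"
        by (subst (asm) sum_nonneg_eq_0_iff) auto
      fix k assume k: "k \<in> {1..N}"
      with \<open>\<forall>k\<in>{1..N}. _\<close> w[OF k] have "?s k = 0" by (metis less_irrefl mult_eq_0_iff)
      then have "x k $$ (i, j) = 0" if "i < d k" "j < d k" for i j
        using that by (simp add: sum_nonneg_eq_0_iff sum_nonneg)
      with k xk[OF k] show "x k = \<zero>\<^bsub>?M\<^esub> k" by (intro eq_matI) auto
    qed (use x in \<open>simp_all add: mem_matrix_sum\<close>)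
    assume y: "y \<in> carrier ?M"
    note yk = matrix_sum_carrier_component[OF y]
    show "(c \<odot>\<^bsub>?M\<^esub> x) \<otimes>\<^bsub>?M\<^esub> y = c \<odot>\<^bsub>?M\<^esub> (x \<otimes>\<^bsub>?M\<^esub> y)"
      by (intro matrix_sum_eqI[where N = N]) (simp_all add: mult_smult_assoc_mat[OF xk yk])
    show "x \<otimes>\<^bsub>?M\<^esub> (c \<odot>\<^bsub>?M\<^esub> y) = c \<odot>\<^bsub>?M\<^esub> (x \<otimes>\<^bsub>?M\<^esub> y)"
      by (intro matrix_sum_eqI[where N = N]) (simp_all add: mult_smult_distrib[OF xk yk])
    show "ds_adjoint N (x \<oplus>\<^bsub>?M\<^esub> y) = ds_adjoint N x \<oplus>\<^bsub>?M\<^esub> ds_adjoint N y"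
      by (intro matrix_sum_eqI[where N = N]) (simp_all add: mat_adjoint_add[OF xk yk])
    show "ds_adjoint N (x \<otimes>\<^bsub>?M\<^esub> y) = ds_adjoint N y \<otimes>\<^bsub>?M\<^esub> ds_adjoint N x"
      by (intro matrix_sum_eqI[where N = N]) (simp_all add: mat_adjoint_mult[OF xk yk])
    show "tau N d v (x \<oplus>\<^bsub>?M\<^esub> y) = tau N d v x + tau N d v y"
      by (simp add: tau_def mat_tr_add[OF xk yk] distrib_left sum.distrib)
    show "tau N d v (x \<otimes>\<^bsub>?M\<^esub> y) = tau N d v (y \<otimes>\<^bsub>?M\<^esub> x)"
      by (simp add: tau_def mat_tr_mult_commute[OF xk yk])
  qed
qed

section \<open>The Euclidean operator norm\<close>

lemma vec_l2norm_nonneg [simp]: "0 \<le> vec_l2norm x"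
  by (simp add: vec_l2norm_def)

lemma vec_l2norm_sq: "(vec_l2norm x)\<^sup>2 = (\<Sum>i<dim_vec x. (cmod (x $ i))\<^sup>2)"
  by (simp add: vec_l2norm_def L2_set_def sum_nonneg)

lemma vec_l2norm_smult: "vec_l2norm (c \<cdot>\<^sub>v x) = cmod c * vec_l2norm x"
  unfolding vec_l2norm_def by (auto simp: L2_set_right_distrib norm_mult intro!: L2_set_cong)

text \<open>The supremum in \<open>op_norm\<close> is informative only for a bounded set; the sum of
  the moduli of all entries is a crude bound.\<close>

lemma op_norm_set_bdd:
  assumes M: "M \<in> carrier_mat m n"
  shows "bdd_above {vec_l2norm (M *\<^sub>v x) | x. x \<in> carrier_vec (dim_col M) \<and> vec_l2norm x \<le> 1}"
proof (rule bdd_aboveI)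
  fix r assume "r \<in> {vec_l2norm (M *\<^sub>v x) | x. x \<in> carrier_vec (dim_col M) \<and> vec_l2norm x \<le> 1}"
  then obtain x where x: "x \<in> carrier_vec n" "vec_l2norm x \<le> 1" and r: "r = vec_l2norm (M *\<^sub>v x)"
    using M by auto
  have x1: "cmod (x $ j) \<le> 1" if "j < n" for j
    using member_le_L2_set[of "{..<n}" j "\<lambda>j. cmod (x $ j)"] that x
    by (simp add: vec_l2norm_def)
  have "r \<le> (\<Sum>i<m. cmod ((M *\<^sub>v x) $ i))"
    using M unfolding r vec_l2norm_def by (auto simp del: index_mult_mat_vec intro: L2_set_le_sum)
  also have "\<dots> \<le> (\<Sum>i<m. \<Sum>j<n. cmod (M $$ (i, j)))"
  proof (rule sum_mono)
    fix i assume i: "i \<in> {..<m}"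
    have "(M *\<^sub>v x) $ i = (\<Sum>j<n. M $$ (i, j) * x $ j)"
      using i M x by (simp add: scalar_prod_def atLeast0LessThan)
    then have "cmod ((M *\<^sub>v x) $ i) \<le> (\<Sum>j<n. cmod (M $$ (i, j) * x $ j))"
      by (metis norm_sum)
    also have "\<dots> \<le> (\<Sum>j<n. cmod (M $$ (i, j)))"
      using x1 by (intro sum_mono) (simp add: norm_mult mult_left_le)
    finally show "cmod ((M *\<^sub>v x) $ i) \<le> (\<Sum>j<n. cmod (M $$ (i, j)))" .
  qed
  finally show "r \<le> (\<Sum>i<m. \<Sum>j<n. cmod (M $$ (i, j)))" .
qed

lemma vec_l2norm_mult_le_op_norm_unit:
  assumes "M \<in> carrier_mat m n" "x \<in> carrier_vec n" "vec_l2norm x \<le> 1"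
  shows "vec_l2norm (M *\<^sub>v x) \<le> op_norm M"
  unfolding op_norm_def using assms by (intro cSup_upper op_norm_set_bdd) auto

lemma op_norm_nonneg:
  assumes M: "M \<in> carrier_mat m n"
  shows "0 \<le> op_norm M"
  using vec_l2norm_mult_le_op_norm_unit[OF M, of "0\<^sub>v n"] vec_l2norm_nonneg[of "M *\<^sub>v 0\<^sub>v n"]
  by (simp add: vec_l2norm_def[of "0\<^sub>v n"] L2_set_def del: vec_l2norm_nonneg)

lemma vec_l2norm_mult_le_op_norm:
  assumes M: "M \<in> carrier_mat m n" and x: "x \<in> carrier_vec n"
  shows "vec_l2norm (M *\<^sub>v x) \<le> op_norm M * vec_l2norm x"
proof (cases "vec_l2norm x = 0")
  case True
  then have "(\<Sum>i<n. (cmod (x $ i))\<^sup>2) = 0" using x vec_l2norm_sq[of x] by simp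
  then have "x $ i = 0" if "i < n" for i using that by (simp add: sum_nonneg_eq_0_iff)
  then have "M *\<^sub>v x = 0\<^sub>v m" using M x by (intro eq_vecI) (auto simp: scalar_prod_def)
  then show ?thesis using True by (simp add: vec_l2norm_def L2_set_def)
next
  case False
  define s where "s = vec_l2norm x"
  have s: "0 < s" using False by (simp add: s_def less_le)
  define y where "y = complex_of_real (1 / s) \<cdot>\<^sub>v x"
  have y: "y \<in> carrier_vec n" "vec_l2norm y \<le> 1"
    using x s by (simp_all add: y_def vec_l2norm_smult s_def[symmetric] norm_divide)
  have "M *\<^sub>v y = complex_of_real (1 / s) \<cdot>\<^sub>v (M *\<^sub>v x)"
    using M x by (simp add: y_def mult_mat_vec)
  then have "vec_l2norm (M *\<^sub>v y) = vec_l2norm (M *\<^sub>v x) / s"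
    using s by (simp add: vec_l2norm_smult norm_divide)
  with vec_l2norm_mult_le_op_norm_unit[OF M y] s show ?thesis
    by (simp add: s_def[symmetric] field_simps)
qed

lemma op_norm_le:
  assumes M: "M \<in> carrier_mat m n"
    and le: "\<And>x. x \<in> carrier_vec n \<Longrightarrow> vec_l2norm x \<le> 1 \<Longrightarrow> vec_l2norm (M *\<^sub>v x) \<le> K"
  shows "op_norm M \<le> K"
  unfolding op_norm_def
proof (rule cSup_least)
  have "vec_l2norm (0\<^sub>v n) \<le> 1" by (simp add: vec_l2norm_def L2_set_def)
  then show "{vec_l2norm (M *\<^sub>v x) | x. x \<in> carrier_vec (dim_col M) \<and> vec_l2norm x \<le> 1} \<noteq> {}"
    using M by (auto intro!: exI[of _ "0\<^sub>v n"])
qed (use assms in auto)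

text \<open>The squared 2-norm is a weighted sum of squared column norms, and left multiplication
  acts on each column separately. So its best bound is the largest operator norm of a
  summand.\<close>

lemma tracial_cstar_algebra_matrix_sum:
  assumes N: "1 \<le> N" and d: "\<And>k. k \<in> {1..N} \<Longrightarrow> 1 \<le> d k" and v: "\<And>k. k \<in> {1..N} \<Longrightarrow> 0 < v k"
  shows "tracial_cstar_algebra (matrix_sum N d) (ds_adjoint N) (tau N d v) (ds_norm N)"
proof -
  let ?M = "matrix_sum N d"
  interpret tracial_star_algebra ?M "ds_adjoint N" "tau N d v"
    by (rule tracial_star_algebra_matrix_sum[OF d v])
  define w where "w k = v k / real (d k)" for k
  have w: "0 < w k" if "k \<in> {1..N}" for k
    using d[OF that] v[OF that] by (simp add: w_def)
  have norm2_formula: "(norm2 x)\<^sup>2 = (\<Sum>k=1..N. w k * (\<Sum>j<d k. (vec_l2norm (col (x k) j))\<^sup>2))"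
    if x: "x \<in> carrier ?M" for x
  proof -
    have "(norm2 x)\<^sup>2 = (\<Sum>k=1..N. w k * (\<Sum>j<d k. \<Sum>i<d k. (cmod (x k $$ (i, j)))\<^sup>2))"
      unfolding norm2_sq[OF x] ip_def tau_adjoint_mult_self[OF x] Re_complex_of_real by (simp add: w_def)
    also have "\<dots> = (\<Sum>k=1..N. w k * (\<Sum>j<d k. (vec_l2norm (col (x k) j))\<^sup>2))"
    proof (intro sum.cong refl arg_cong2[of _ _ _ _ "(*)"])
      fix k j assume "k \<in> {1..N}" "j \<in> {..<d k}"
      then show "(\<Sum>i<d k. (cmod (x k $$ (i, j)))\<^sup>2) = (vec_l2norm (col (x k) j))\<^sup>2"
        using matrix_sum_carrier_component[OF x, of k] by (auto simp: vec_l2norm_sq)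
    qed
    finally show ?thesis .
  qed
  have norm2_mult: "(norm2 (a \<otimes>\<^bsub>?M\<^esub> x))\<^sup>2 =
      (\<Sum>k=1..N. w k * (\<Sum>j<d k. (vec_l2norm (a k *\<^sub>v col (x k) j))\<^sup>2))"
    if a: "a \<in> carrier ?M" and x: "x \<in> carrier ?M" for a x
    unfolding norm2_formula[OF m_closed[OF a x]]
  proof (intro sum.cong refl arg_cong2[of _ _ _ _ "(*)"])
    fix k j assume "k \<in> {1..N}" "j \<in> {..<d k}"
    then show "(vec_l2norm (col ((a \<otimes>\<^bsub>?M\<^esub> x) k) j))\<^sup>2 = (vec_l2norm (a k *\<^sub>v col (x k) j))\<^sup>2"
      using col_mult2[OF matrix_sum_carrier_component[OF a] matrix_sum_carrier_component[OF x], of k j] by simp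
  qed
  have op_norm_le_ds: "op_norm (a k) \<le> ds_norm N a" if "k \<in> {1..N}" for a k
    unfolding ds_norm_def using that by (intro Max_ge) auto
  show ?thesis
  proof
    fix a assume a: "a \<in> carrier ?M"
    note ak = matrix_sum_carrier_component[OF a]
    show ds_nonneg: "0 \<le> ds_norm N a"
      using op_norm_nonneg[OF ak[of 1]] op_norm_le_ds[of 1 a] N by simp
    show "norm2 (a \<otimes>\<^bsub>?M\<^esub> x) \<le> ds_norm N a * norm2 x" if x: "x \<in> carrier ?M" for x
    proof (rule power2_le_imp_le)
      have "(norm2 (a \<otimes>\<^bsub>?M\<^esub> x))\<^sup>2 \<le>
          (\<Sum>k=1..N. w k * (\<Sum>j<d k. (ds_norm N a * vec_l2norm (col (x k) j))\<^sup>2))"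
        unfolding norm2_mult[OF a x]
      proof (intro sum_mono mult_left_mono power_mono)
        fix k j assume k: "k \<in> {1..N}" and j: "j \<in> {..<d k}"
        have "vec_l2norm (a k *\<^sub>v col (x k) j) \<le> op_norm (a k) * vec_l2norm (col (x k) j)"
          using matrix_sum_carrier_component[OF x k] j by (intro vec_l2norm_mult_le_op_norm[OF ak[OF k]]) auto
        also have "\<dots> \<le> ds_norm N a * vec_l2norm (col (x k) j)"
          using op_norm_le_ds[OF k] by (intro mult_right_mono) auto
        finally show "vec_l2norm (a k *\<^sub>v col (x k) j) \<le> ds_norm N a * vec_l2norm (col (x k) j)" .
      qed (use w in \<open>auto simp: less_imp_le\<close>)
      also have "\<dots> = (ds_norm N a * norm2 x)\<^sup>2"
        unfolding power_mult_distrib norm2_formula[OF x] by (simp add: sum_distrib_left mult.left_commute)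
      finally show "(norm2 (a \<otimes>\<^bsub>?M\<^esub> x))\<^sup>2 \<le> (ds_norm N a * norm2 x)\<^sup>2" .
    qed (use ds_nonneg x in simp)
    show "ds_norm N a \<le> K"
      if K: "0 \<le> K" and le: "\<And>y. y \<in> carrier ?M \<Longrightarrow> norm2 (a \<otimes>\<^bsub>?M\<^esub> y) \<le> K * norm2 y" for K
    proof -
      have "op_norm (a k) \<le> K" if k: "k \<in> {1..N}" for k
      proof (rule op_norm_le[OF ak[OF k]])
        fix u :: "complex vec"
        assume u: "u \<in> carrier_vec (d k)" "vec_l2norm u \<le> 1"
        \<comment> \<open>All of \<open>y\<close> vanishes except column 0 of summand
          \<open>k\<close>, which is \<open>u\<close>; this isolates the action of
          \<open>a k\<close> on \<open>u\<close>. The column exists because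
          \<open>1 \<le> d k\<close>.\<close>
        define y where "y = (\<lambda>l\<in>{1..N}. mat (d l) (d l) (\<lambda>(p, q). if l = k \<and> q = 0 then u $ p else 0))"
        have y: "y \<in> carrier ?M" by (simp add: mem_matrix_sum y_def)
        have col_y: "col (y l) j = (if l = k \<and> j = 0 then u else 0\<^sub>v (d l))"
          if "l \<in> {1..N}" "j < d l" for l j
          using that u by (intro eq_vecI) (auto simp: y_def)
        \<comment> \<open>Stated for a general \<open>f\<close> to serve both \<open>y\<close> and
          \<open>a \<otimes> y\<close>.\<close>
        have sum_single: "(\<Sum>l=1..N. w l * (\<Sum>j<d l. (f l (col (y l) j))\<^sup>2)) = w k * (f k u)\<^sup>2"
          if f: "\<And>l. l \<in> {1..N} \<Longrightarrow> f l (0\<^sub>v (d l)) = 0" for f :: "nat \<Rightarrow> complex vec \<Rightarrow> real"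
        proof -
          have "(\<Sum>l=1..N. w l * (\<Sum>j<d l. (f l (col (y l) j))\<^sup>2)) = (\<Sum>l=1..N. if l = k then w k * (f k u)\<^sup>2 else 0)"
          proof (intro sum.cong refl)
            fix l assume l: "l \<in> {1..N}"
            have "(\<Sum>j<d l. (f l (col (y l) j))\<^sup>2) = (\<Sum>j<d l. if j = 0 then if l = k then (f k u)\<^sup>2 else 0 else 0)"
              using l f by (intro sum.cong refl) (simp add: col_y)
            also have "\<dots> = (if l = k then (f k u)\<^sup>2 else 0)"
              using d[OF l] by simp
            finally show "w l * (\<Sum>j<d l. (f l (col (y l) j))\<^sup>2) = (if l = k then w k * (f k u)\<^sup>2 else 0)"
              by simp
          qed
          also have "\<dots> = w k * (f k u)\<^sup>2" using k by simp
          finally show ?thesis .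
        qed
        have zero: "vec_l2norm (0\<^sub>v n) = 0" for n by (simp add: vec_l2norm_def L2_set_def)
        have "(norm2 y)\<^sup>2 = w k * (vec_l2norm u)\<^sup>2"
          unfolding norm2_formula[OF y] by (rule sum_single) (rule zero)
        moreover have "(norm2 (a \<otimes>\<^bsub>?M\<^esub> y))\<^sup>2 = w k * (vec_l2norm (a k *\<^sub>v u))\<^sup>2"
          unfolding norm2_mult[OF a y]
        proof (rule sum_single)
          fix l assume "l \<in> {1..N}"
          then have "a l *\<^sub>v 0\<^sub>v (d l) = 0\<^sub>v (d l)" using ak[of l] by (intro eq_vecI) auto
          then show "vec_l2norm (a l *\<^sub>v 0\<^sub>v (d l)) = 0" by (simp add: zero)
        qed
        moreover have "(norm2 (a \<otimes>\<^bsub>?M\<^esub> y))\<^sup>2 \<le> (K * norm2 y)\<^sup>2"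
          using le[OF y] a y by (intro power_mono) auto
        ultimately have "w k * (vec_l2norm (a k *\<^sub>v u))\<^sup>2 \<le> w k * (K * vec_l2norm u)\<^sup>2"
          by (simp add: power_mult_distrib mult.left_commute)
        then have "(vec_l2norm (a k *\<^sub>v u))\<^sup>2 \<le> (K * vec_l2norm u)\<^sup>2"
          using w[OF k] by (simp only: mult_le_cancel_left_pos)
        then have "vec_l2norm (a k *\<^sub>v u) \<le> K * vec_l2norm u"
          by (rule power2_le_imp_le) (use K in simp)
        also have "\<dots> \<le> K" using mult_left_mono[OF u(2) K] by simp
        finally show "vec_l2norm (a k *\<^sub>v u) \<le> K" .
      qed
      then show ?thesis unfolding ds_norm_def using N by (intro Max.boundedI) auto
    qed
  qed
qed


subsection \<open>Standard bases\<close>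

lemma matrix_sum_finsum_entry:
  assumes "finite S" "f \<in> S \<rightarrow> carrier (matrix_sum N d)" "k \<in> {1..N}" "i < d k" "j < d k"
  shows "(\<Oplus>\<^bsub>matrix_sum N d\<^esub> s\<in>S. f s) k $$ (i, j) = (\<Sum>s\<in>S. f s k $$ (i, j))"
proof -
  interpret ring "matrix_sum N d" by (rule ring_matrix_sum)
  from assms(1,2) show ?thesis
  proof (induction S rule: finite_induct)
    case empty
    then show ?case using assms by simp
  next
    case (insert s S)
    then have "(\<Oplus>\<^bsub>matrix_sum N d\<^esub> s\<in>S. f s) \<in> carrier (matrix_sum N d)"
      by (intro finsum_closed) auto
    from matrix_sum_carrier_component[OF this assms(3)] insert assms(3-) show ?case
      by (simp add: Pi_iff)
  qed
qed

lemma matrix_unit_carrier: "matrix_unit N d k i j \<in> carrier (matrix_sum N d)"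
  by (simp add: mem_matrix_sum matrix_unit_def)

lemma finite_positions: "finite (positions N d)"
  by (simp add: positions_def)

lemma sum_matrix_units_entry:
  assumes "S \<subseteq> positions N d" "k \<in> {1..N}" "i < d k" "j < d k"
  shows "(\<Oplus>\<^bsub>matrix_sum N d\<^esub> s\<in>S. case s of (k, i, j) \<Rightarrow> matrix_unit N d k i j) k $$ (i, j) =
    (if (k, i, j) \<in> S then 1 else 0)"
proof -
  have "finite S" using assms(1) finite_positions by (rule finite_subset)
  have "(\<Oplus>\<^bsub>matrix_sum N d\<^esub> s\<in>S. case s of (k, i, j) \<Rightarrow> matrix_unit N d k i j) k $$ (i, j) =
      (\<Sum>s\<in>S. (case s of (k, i, j) \<Rightarrow> matrix_unit N d k i j) k $$ (i, j))"
    using assms \<open>finite S\<close> by (intro matrix_sum_finsum_entry) (auto simp: matrix_unit_carrier)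
  also have "\<dots> = (\<Sum>s\<in>S. if s = (k, i, j) then 1 else 0)"
    using assms by (intro sum.cong) (auto simp: matrix_unit_def split: prod.splits)
  finally show ?thesis using \<open>finite S\<close> by simp
qed

text \<open>Conjugation does nothing to 0 and 1, so pairing with \<open>X\<close> is summation over
  its support.\<close>

lemma sum_zero_one_entries:
  fixes X Y :: "complex mat"
  assumes "\<And>i j. i < n \<Longrightarrow> j < n \<Longrightarrow> X $$ (i, j) \<in> {0, 1}"
  shows "(\<Sum>j<n. \<Sum>i<n. cnj (X $$ (i, j)) * Y $$ (i, j)) =
    (\<Sum>(i, j)\<in>{(i, j). i < n \<and> j < n \<and> X $$ (i, j) = 1}. Y $$ (i, j))"
proof -
  have "(\<Sum>j<n. \<Sum>i<n. cnj (X $$ (i, j)) * Y $$ (i, j)) =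
      (\<Sum>(i, j)\<in>{..<n} \<times> {..<n}. cnj (X $$ (i, j)) * Y $$ (i, j))"
    by (subst sum.swap) (simp add: sum.cartesian_product)
  also have "\<dots> = (\<Sum>(i, j)\<in>{(i, j). i < n \<and> j < n \<and> X $$ (i, j) = 1}. Y $$ (i, j))"
    using assms by (intro sum.mono_neutral_cong_right) force+
  finally show ?thesis .
qed

text \<open>Disjoint supports make \<beta> orthogonal for the trace form, so the expectation is the
  Fourier expansion in \<beta>; zero-one entries turn its coefficients into sums over
  supports.\<close>

theorem theorem3p15:
  fixes N :: nat and d :: "nat \<Rightarrow> nat" and v :: "nat \<Rightarrow> real"
    and \<B> \<beta> :: "(nat \<Rightarrow> complex mat) set" and A :: "nat \<Rightarrow> complex mat"
  assumes "1 \<le> N" and "\<And>k. k \<in> {1..N} \<Longrightarrow> 1 \<le> d k"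
    and "standard_subalgebra N d \<B>"
    and "standard_basis N d \<B> \<beta>"
    and "weight_vector N v"
    and "A \<in> carrier (matrix_sum N d)"
  shows "cond_exp N d v \<B> A =
    (\<Oplus>\<^bsub>matrix_sum N d\<^esub> B\<in>\<beta>.
      ((\<Sum>k=1..N. complex_of_real (v k / real (d k)) * (\<Sum>(i, j)\<in>Psi d B k. A k $$ (i, j))) /
       complex_of_real (\<Sum>k=1..N. real (card (Psi d B k)) * v k / real (d k)))
      \<odot>\<^bsub>matrix_sum N d\<^esub> B)"
proof -
  let ?M = "matrix_sum N d"
  have v: "0 < v k" if "k \<in> {1..N}" for k
    using assms(5) that by (auto simp: weight_vector_def split: if_splits)
  interpret tracial_cstar_algebra ?M "ds_adjoint N" "tau N d v" "ds_norm N"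
    by (rule tracial_cstar_algebra_matrix_sum[OF assms(1,2) v])
  have "unital_cstar_subalgebra N d \<B>" using assms(3) by (simp add: standard_subalgebra_def)
  then interpret unital_star_subalgebra ?M "ds_adjoint N" "tau N d v" "ds_norm N" \<B>
    by unfold_locales (auto simp: unital_cstar_subalgebra_def submodule_def)
  interpret V: vectorspace class_ring "?M\<lparr>carrier := \<B>\<rparr>" by (rule sub_vectorspace)
  have basis: "V.basis \<beta>"
    and units: "\<And>X. X \<in> \<beta> \<Longrightarrow> \<exists>S. S \<subseteq> positions N d \<and> S \<noteq> {} \<and>
      X = (\<Oplus>\<^bsub>?M\<^esub> s\<in>S. case s of (k, i, j) \<Rightarrow> matrix_unit N d k i j)"
    and disj: "disjoint_family_on (\<lambda>X. SIGMA k:{1..N}. Psi d X k) \<beta>"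
    using assms(4) by (simp_all add: standard_basis_def)
  have sub: "\<beta> \<subseteq> \<B>" and gen: "V.span \<beta> = \<B>"
    using basis by (simp_all add: V.basis_def)
  have entries: "X k $$ (i, j) \<in> {0, 1}"
    if "X \<in> \<beta>" "k \<in> {1..N}" "i < d k" "j < d k" for X k i j
    using units[OF that(1)] that(2-) by (auto simp: sum_matrix_units_entry split: if_splits)
  \<comment> \<open>Disjoint supports can coincide only if empty. So nonemptiness makes the support
    determine the basis element, which gives finiteness of \<beta>, and it also excludes zero from
    \<beta>.\<close>
  have nonempty: "(SIGMA k:{1..N}. Psi d X k) \<noteq> {}" if X: "X \<in> \<beta>" for X
  proof -
    obtain S where S: "S \<subseteq> positions N d" "S \<noteq> {}"
      "X = (\<Oplus>\<^bsub>?M\<^esub> s\<in>S. case s of (k, i, j) \<Rightarrow> matrix_unit N d k i j)"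
      using units[OF X] by blast
    then obtain k i j where kij: "(k, i, j) \<in> S" by auto
    with S(1) have "k \<in> {1..N}" "i < d k" "j < d k" by (auto simp: positions_def)
    with kij have "(k, i, j) \<in> (SIGMA k:{1..N}. Psi d X k)"
      using sum_matrix_units_entry[OF S(1), of k i j] S(3) by (simp add: Psi_def)
    then show ?thesis by blast
  qed
  have "inj_on (\<lambda>X. SIGMA k:{1..N}. Psi d X k) \<beta>"
    using disj nonempty by (force simp: inj_on_def disjoint_family_on_def)
  moreover have "(\<lambda>X. SIGMA k:{1..N}. Psi d X k) ` \<beta> \<subseteq> Pow (positions N d)"
    by (auto simp: Psi_def positions_def)
  ultimately have "finite \<beta>"
    using finite_positions by (meson finite_Pow_iff inj_on_finite)
  \<comment> \<open>This is the numerator of the claimed coefficient; with \<open>x = X\<close> it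
    becomes the denominator, since each entry on the support is 1.\<close>
  have ip_basis: "ip x X = (\<Sum>k=1..N. complex_of_real (v k / real (d k)) * (\<Sum>(i, j)\<in>Psi d X k. x k $$ (i, j)))"
    if X: "X \<in> \<beta>" and x: "x \<in> carrier ?M" for X x
  proof -
    have "X \<in> carrier ?M" using X sub by auto
    then show ?thesis
      unfolding ip_def Psi_def tau_adjoint_mult[OF x \<open>X \<in> carrier ?M\<close>]
      by (intro sum.cong refl arg_cong2[of _ _ _ _ "(*)"] sum_zero_one_entries entries[OF X])
  qed
  have "ip X Y = 0" if X: "X \<in> \<beta>" and Y: "Y \<in> \<beta>" and "X \<noteq> Y" for X Y
  proof -
    have "X k $$ (i, j) = 0" if "k \<in> {1..N}" "(i, j) \<in> Psi d Y k" for k i j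
    proof -
      have "(k, i, j) \<notin> (SIGMA k:{1..N}. Psi d X k)"
        using disj X Y \<open>X \<noteq> Y\<close> that by (force simp: disjoint_family_on_def)
      then show ?thesis using entries[OF X, of k i j] that by (auto simp: Psi_def)
    qed
    then have "(\<Sum>(i, j)\<in>Psi d Y k. X k $$ (i, j)) = 0" if "k \<in> {1..N}" for k
      using that by (intro sum.neutral) auto
    then show ?thesis using X Y sub by (simp add: ip_basis subset_iff)
  qed
  moreover have "\<zero>\<^bsub>?M\<^esub> \<notin> \<beta>"
    using nonempty by (force simp: Psi_def)
  moreover have "ip X X = complex_of_real (\<Sum>k=1..N. real (card (Psi d X k)) * v k / real (d k))"
    if X: "X \<in> \<beta>" for X
  proof -
    have "(\<Sum>(i, j)\<in>Psi d X k. X k $$ (i, j)) = of_nat (card (Psi d X k))" for k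
    proof -
      have "(\<Sum>(i, j)\<in>Psi d X k. X k $$ (i, j)) = (\<Sum>p\<in>Psi d X k. 1)"
        by (intro sum.cong) (auto simp: Psi_def)
      then show ?thesis by simp
    qed
    then show ?thesis using X sub by (simp add: ip_basis subset_iff mult.commute)
  qed
  ultimately show ?thesis
    unfolding cond_exp_def conditional_expectation_def
    using the_trace_preserving_expectation_basis[OF \<open>finite \<beta>\<close> sub gen _ _ assms(6)] assms(6) sub
    by (auto simp: ip_basis intro!: finsum_cong)
qed

end
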